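(* Let $k$ be a positive integer and let $G$ be a $k$-connected graph. Let $k_1,k_2,k_3$ be integers such that $k_1,k_2>0$, $k_3\ge 0$, and $k_1+k_2+k_3\le k$. Then $G$ is $F_{k_1,k_2,k_3}$-linked.
   Context: For a multigraph $H$, a graph $G$ is $H$-linked if for every injective map $\phi:V(H)\to V(G)$ there is a map $\psi$ assigning to each edge $uv\in E(H)$ a $\phi(u),\phi(v)$-path $\psi(uv)$ in $G$, such that distinct edges of $H$ (including parallel edges) are mapped to internally disjoint paths. For nonnegative integers $k_1,k_2,k_3$, the fat-triangle $F_{k_1,k_2,k_3}$ is the multigraph with vertex set $\{v_1,v_2,v_3\}$ having exactly $k_1$ edges joining $v_1,v_2$, exactly $k_2$ edges joining $v_2,v_3$, and exactly $k_3$ edges joining $v_3,v_1$ (and no loops). *)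

theory Defs
  imports "Graph_Theory.Graph_Theory" "HOL-Library.Uprod"
begin

text \<open>
  The host graph is a finite simple graph, i.e. a \<open>pre_digraph\<close> satisfying the locale predicate
  \<open>graph\<close> (each undirected edge is a pair of opposite arcs, no loops, no parallel arcs).
\<close>

definition k_connected :: "nat \<Rightarrow> ('a, 'b) pre_digraph \<Rightarrow> bool" where
  "k_connected k G \<longleftrightarrow>
     card (verts G) > k \<and>
     (\<forall>S \<subseteq> verts G. card S < k \<longrightarrow> connected (G \<restriction> (verts G - S)))"

record ('v, 'e) multigraph =
  mverts :: "'v set"
  medges :: "'e set"
  ends :: "'e \<Rightarrow> 'v uprod"

text \<open>
  Paths of the host graph are represented by their vertex sequences; a sequence and its reversal
  represent the same undirected path.
\<close>

definition internal_verts :: "'a list \<Rightarrow> 'a set" where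
  "internal_verts p = set (butlast (tl p))"

text \<open>
  Internally disjoint paths are different paths, neither of which contains an internal vertex of
  the other. Difference has to be required separately: a path consisting of one edge has no
  internal vertices, but it may not be used for two parallel edges.
\<close>

definition internally_disjoint :: "'a list \<Rightarrow> 'a list \<Rightarrow> bool" where
  "internally_disjoint p q \<longleftrightarrow>
     p \<noteq> q \<and> p \<noteq> rev q \<and>
     internal_verts p \<inter> set q = {} \<and> internal_verts q \<inter> set p = {}"

definition linked :: "('v, 'e) multigraph \<Rightarrow> ('a, 'b) pre_digraph \<Rightarrow> bool" where
  "linked H G \<longleftrightarrow>
     (\<forall>\<phi>. inj_on \<phi> (mverts H) \<and> \<phi> ` mverts H \<subseteq> verts G \<longrightarrow>
       (\<exists>\<psi>. (\<forall>e \<in> medges H. vpath (\<psi> e) G \<and>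
                Upair (hd (\<psi> e)) (last (\<psi> e)) = map_uprod \<phi> (ends H e)) \<and>
            (\<forall>e \<in> medges H. \<forall>f \<in> medges H. e \<noteq> f \<longrightarrow> internally_disjoint (\<psi> e) (\<psi> f))))"

text \<open>The edge \<open>(i, j)\<close> is the \<open>j\<close>-th of the parallel edges in the \<open>i\<close>-th class.\<close>

definition fat_triangle :: "nat \<Rightarrow> nat \<Rightarrow> nat \<Rightarrow> (nat, nat \<times> nat) multigraph" where
  "fat_triangle k1 k2 k3 =
     \<lparr> mverts = {1, 2, 3},
       medges = {1} \<times> {..<k1} \<union> {2} \<times> {..<k2} \<union> {3} \<times> {..<k3},
       ends = (\<lambda>(i, j). if i = 1 then Upair 1 2 else if i = 2 then Upair 2 3 else Upair 3 1) \<rparr>"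

lemma card_edges_fat_triangle:
  "card {e \<in> medges (fat_triangle k1 k2 k3). ends (fat_triangle k1 k2 k3) e = Upair 1 2} = k1"
  "card {e \<in> medges (fat_triangle k1 k2 k3). ends (fat_triangle k1 k2 k3) e = Upair 2 3} = k2"
  "card {e \<in> medges (fat_triangle k1 k2 k3). ends (fat_triangle k1 k2 k3) e = Upair 3 1} = k3"
proof -
  have "{e \<in> medges (fat_triangle k1 k2 k3). ends (fat_triangle k1 k2 k3) e = Upair 1 2}
      = {1} \<times> {..<k1}"
    by (auto simp: fat_triangle_def)
  then show "card {e \<in> medges (fat_triangle k1 k2 k3).
      ends (fat_triangle k1 k2 k3) e = Upair 1 2} = k1" by simp
  have "{e \<in> medges (fat_triangle k1 k2 k3). ends (fat_triangle k1 k2 k3) e = Upair 2 3}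
      = {2} \<times> {..<k2}"
    by (auto simp: fat_triangle_def)
  then show "card {e \<in> medges (fat_triangle k1 k2 k3).
      ends (fat_triangle k1 k2 k3) e = Upair 2 3} = k2" by simp
  have "{e \<in> medges (fat_triangle k1 k2 k3). ends (fat_triangle k1 k2 k3) e = Upair 3 1}
      = {3} \<times> {..<k3}"
    by (auto simp: fat_triangle_def)
  then show "card {e \<in> medges (fat_triangle k1 k2 k3).
      ends (fat_triangle k1 k2 k3) e = Upair 3 1} = k3" by simp
qed

end

theory Submission
  imports Defs
begin

text \<open>
  Work in the subdivision of \<open>G\<close>, so that distinctness of parallel one-edge paths becomes
  disjointness. Let \<open>a\<close>, \<open>b\<close>, \<open>c\<close> be the images of the three branch vertices and \<open>k = k1 + k2 + k3\<close>.
  Menger's theorem gives a fan from \<open>b\<close> of \<open>k - 1\<close> paths to \<open>a\<close> and one path to \<open>c\<close>. While there are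
  more than \<open>k1\<close> paths joining \<open>a\<close> and \<open>b\<close>, one of them is exchanged for a path joining \<open>c\<close> and \<open>a\<close> (or
  \<open>c\<close> and \<open>b\<close>, by symmetry): augment the fan leaving \<open>c\<close>, keeping all its end vertices, towards the
  target set consisting of the \<open>a\<close>-\<open>b\<close> paths and the edges at \<open>a\<close>. The additional path either reaches
  \<open>a\<close> directly or hits an \<open>a\<close>-\<open>b\<close> path, which it then follows to \<open>a\<close>.
\<close>

section \<open>Menger's theorem\<close>

definition simple_path :: "('n \<Rightarrow> 'n \<Rightarrow> bool) \<Rightarrow> 'n list \<Rightarrow> bool" where
  "simple_path E p \<longleftrightarrow> p \<noteq> [] \<and> distinct p \<and> successively E p"

text \<open>Augmentation keeps \<open>A\<close> fixed and works at the \<open>B\<close> ends alone,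
  hence the asymmetry: inner nodes avoid \<open>B\<close> but may meet \<open>A\<close>.\<close>

definition set_path :: "('n \<Rightarrow> 'n \<Rightarrow> bool) \<Rightarrow> 'n set \<Rightarrow> 'n set \<Rightarrow> 'n list \<Rightarrow> bool" where
  "set_path E A B p \<longleftrightarrow>
     simple_path E p \<and> hd p \<in> A \<and> last p \<in> B \<and> set (butlast p) \<inter> B = {}"

abbreviation disjoint_lists :: "'n list set \<Rightarrow> bool" where
  "disjoint_lists F \<equiv> pairwise (\<lambda>p q. set p \<inter> set q = {}) F"

lemma set_eq_insert_last_butlast: "p \<noteq> [] \<Longrightarrow> set p = insert (last p) (set (butlast p))"
  by (metis append_butlast_last_id list.set(2) list.simps(15) rotate1.simps(2) set_rotate1)

lemma simple_path_append:
  assumes "simple_path E q" "simple_path E (last q # r)" "set (butlast q) \<inter> set r = {}"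
  shows "simple_path E (q @ r)"
  using assms unfolding simple_path_def
  by (cases r) (auto simp: successively_append_iff set_eq_insert_last_butlast[of q])

lemma simple_path_appendD:
  assumes "simple_path E (p @ x # r)"
  shows "simple_path E (p @ [x])" "simple_path E (x # r)"
  using assms unfolding simple_path_def by (auto simp: successively_append_iff)

lemma simple_path_rev:
  assumes "symp E" "simple_path E p" shows "simple_path E (rev p)"
  using assms unfolding simple_path_def
  by (auto elim: successively_mono simp: symp_def)

text \<open>If the new first node \<open>x\<close> already lies on the path, the part before
  \<open>x\<close> is cut off; otherwise \<open>x\<close> is prepended.\<close>

lemma rtranclp_imp_simple_path:
  assumes "E\<^sup>*\<^sup>* x y"
  shows "\<exists>p. simple_path E p \<and> hd p = x \<and> last p = y"
  using assms
proof (induction rule: converse_rtranclp_induct)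
  case base
  have "simple_path E [y]" by (simp add: simple_path_def)
  then show ?case by force
next
  case (step x z)
  then obtain p where p: "simple_path E p" "hd p = z" "last p = y" by blast
  show ?case
  proof (cases "x \<in> set p")
    case True
    then obtain p1 p2 where "p = p1 @ x # p2" by (meson split_list)
    then show ?thesis using p simple_path_appendD(2)[of E p1 x p2]
      by (intro exI[of _ "x # p2"]) auto
  next
    case False
    then show ?thesis using p step.hyps(1) unfolding simple_path_def
      by (intro exI[of _ "x # p"]) (auto simp: successively_Cons)
  qed
qed

lemma rtranclp_weaken: "R\<^sup>*\<^sup>* x y \<Longrightarrow> (\<And>x y. R x y \<Longrightarrow> Q x y) \<Longrightarrow> Q\<^sup>*\<^sup>* x y"
  by (metis mono_rtranclp)

lemma successively_all:
  assumes "successively R p" "\<And>x y. R x y \<Longrightarrow> P y" "P (hd p)" "x \<in> set p"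
  shows "P x"
  using assms
  by (induction p rule: induct_list012) auto

text \<open>A common last element would lie in both lists. Path systems can thus be counted by their
  end nodes.\<close>

lemma inj_on_last_disjoint_lists:
  assumes "disjoint_lists F" "\<And>p. p \<in> F \<Longrightarrow> p \<noteq> []"
  shows "inj_on last F"
proof (rule inj_onI)
  fix p q assume *: "p \<in> F" "q \<in> F" "last p = last q"
  then have "last p \<in> set p \<inter> set q" using assms(2) by (metis IntI last_in_set)
  then show "p = q" using assms(1) * unfolding pairwise_def by blast
qed

text \<open>
  Menger's theorem in the augmenting form of Boehme, Goering and Harant. Take a path \<open>r\<close> avoiding
  the end vertices of \<open>F\<close> and let \<open>x\<close> be its last vertex on a member \<open>p\<close> of \<open>F\<close>. Shortening \<open>p\<close> to
  end in \<open>x\<close> and adding the remainders of \<open>p\<close> and \<open>r\<close> to the target set allows an induction on the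
  total length.
\<close>

lemma menger_augment:
  assumes "finite F" "disjoint_lists F" "\<And>p. p \<in> F \<Longrightarrow> set_path E A B p"
    and "\<And>S. finite S \<Longrightarrow> card S \<le> card F \<Longrightarrow>
      \<exists>p. simple_path E p \<and> hd p \<in> A \<and> last p \<in> B \<and> set p \<inter> S = {}"
  shows "\<exists>Q. finite Q \<and> card Q = Suc (card F) \<and> disjoint_lists Q \<and>
    (\<forall>p \<in> Q. set_path E A B p) \<and> last ` F \<subseteq> last ` Q"
  using assms
proof (induction "\<Sum>p\<in>F. length p" arbitrary: F B rule: less_induct)
  case less
  note fin = less.prems(1) and dis = less.prems(2) and pth = less.prems(3) and sep = less.prems(4)
  have "finite (last ` F)" "card (last ` F) \<le> card F" using fin card_image_le by auto
  from sep[OF this] obtain r0 where r0: "simple_path E r0" "hd r0 \<in> A" "last r0 \<in> B"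
    "set r0 \<inter> last ` F = {}" by blast
  then have "\<exists>x \<in> set r0. x \<in> B" using last_in_set simple_path_def by metis
  then obtain ys e zs where r0_eq: "r0 = ys @ e # zs" and e: "e \<in> B" and ys: "\<forall>y \<in> set ys. y \<notin> B"
    using split_list_first_prop[of r0 "\<lambda>x. x \<in> B"] by blast
  define r where "r = ys @ [e]"
  have r: "simple_path E r" "hd r \<in> A" "last r \<in> B" "set r \<inter> last ` F = {}"
    "set (butlast r) \<inter> B = {}"
    using r0 e ys simple_path_appendD(1)[of E ys e zs] unfolding r_def r0_eq
    by (auto simp: hd_append)
  show ?case
  proof (cases "\<exists>x \<in> set r. x \<in> \<Union>(set ` F)")
    case False
    then have "r \<notin> F" using r(1) unfolding simple_path_def
      by (metis UN_I hd_in_set)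
    moreover have "disjoint_lists (insert r F)"
      using dis False by (auto simp: pairwise_insert)
    ultimately show ?thesis
      using fin pth r by (intro exI[of _ "insert r F"]) (auto simp: set_path_def)
  next
    case True
    then obtain r1 x r2 where r_eq: "r = r1 @ x # r2" and x: "x \<in> \<Union>(set ` F)"
      and r2: "\<forall>y \<in> set r2. y \<notin> \<Union>(set ` F)"
      using split_list_last_prop[of r "\<lambda>x. x \<in> \<Union>(set ` F)"] by blast
    from x obtain p where p: "p \<in> F" "x \<in> set p" by blast
    then obtain p1 p2 where p_eq: "p = p1 @ x # p2" by (meson split_list)
    have pp: "set_path E A B p" using pth p by blast
    \<comment> \<open>\<open>r\<close> avoids all ends of \<open>F\<close>, so the remainder
      \<open>p2\<close> is nonempty and cutting it off reduces the total length.\<close>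
    have xnl: "x \<noteq> last p" using r(4) p(1) r_eq by auto
    then have p2: "p2 \<noteq> []" using p_eq by auto
    then have last_p: "last p = last p2" "last p2 \<in> set p2" using p_eq by auto
    have xB: "x \<notin> B" using pp p2 unfolding set_path_def p_eq
      by (auto simp: butlast_append)
    then have r2n: "r2 \<noteq> []" using r(3) r_eq by auto
    then have last_r: "last r = last r2" "last r2 \<in> set r2" using r_eq by auto
    have p1B: "set p1 \<inter> B = {}" and p2B: "set (butlast p2) \<inter> B = {}"
      using pp p2 unfolding set_path_def p_eq by (auto simp: butlast_append)
    have r2B: "set (butlast r2) \<inter> B = {}"
      using r(5) r2n unfolding r_eq by (auto simp: butlast_append)
    have sp: "simple_path E (p1 @ [x])" "simple_path E (x # p2)" "simple_path E (x # r2)"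
      using pp r(1) simple_path_appendD unfolding set_path_def p_eq r_eq by metis+
    have dp: "distinct (p1 @ x # p2)" "distinct (x # r2)"
      using pp sp(3) unfolding set_path_def p_eq simple_path_def by auto
    have p2F: "q = p" if "q \<in> F" "set q \<inter> set p \<noteq> {}" for q
      using dis p(1) that unfolding pairwise_def by blast
    have pr2: "set p \<inter> set r2 = {}" using r2 p(1) by blast
    define F0 where "F0 = F - {p}"
    define p' where "p' = p1 @ [x]"
    define B' where "B' = B \<union> set (x # p2) \<union> set (x # r2)"
    define F' where "F' = insert p' F0"
    have finF0: "finite F0" using fin F0_def by auto
    have F0p: "set q \<inter> set p = {}" if "q \<in> F0" for q
      using p2F[of q] that unfolding F0_def by blast
    have F0r: "set q \<inter> set r2 = {}" if "q \<in> F0" for q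
      using r2 that unfolding F0_def by blast
    have F0ne: "q \<noteq> []" if "q \<in> F0" for q
      using pth that unfolding F0_def set_path_def simple_path_def by blast
    have p'F0: "p' \<notin> F0" using F0p[of p'] unfolding p'_def p_eq by auto
    have F_eq: "F = insert p F0" using p(1) F0_def by auto
    have pF0: "p \<notin> F0" by (simp add: F0_def)
    have cardF': "card F' = card F"
      using p'F0 finF0 pF0 unfolding F'_def F_eq by simp
    have sum_less: "(\<Sum>q\<in>F'. length q) < (\<Sum>q\<in>F. length q)"
      using p'F0 pF0 finF0 p2 unfolding F'_def F_eq by (simp add: p'_def p_eq)
    have disF0: "disjoint_lists F0" using dis F0_def by (simp add: pairwise_mono)
    have disF': "disjoint_lists F'"
      using disF0 F0p unfolding F'_def p'_def p_eq by (auto simp: pairwise_insert)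
    have pathF': "set_path E A B' q" if "q \<in> F'" for q
    proof (cases "q = p'")
      case True
      have "hd p' \<in> A" using pp unfolding set_path_def p'_def p_eq by (cases p1) auto
      moreover have "set p1 \<inter> B' = {}"
        using p1B dp(1) pr2 unfolding B'_def p_eq by auto
      ultimately show ?thesis using sp(1) True unfolding set_path_def B'_def p'_def by auto
    next
      case False
      then have q: "q \<in> F0" using that F'_def by auto
      then have "set_path E A B q" using pth F0_def by auto
      then show ?thesis using F0p[OF q] F0r[OF q] unfolding set_path_def B'_def p_eq
        by (auto dest: in_set_butlastD)
    qed
    have "\<exists>q. simple_path E q \<and> hd q \<in> A \<and> last q \<in> B' \<and> set q \<inter> S = {}"
      if "finite S" "card S \<le> card F'" for S
      using sep[of S] that cardF' unfolding B'_def by auto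
    with less.hyps[OF sum_less _ disF' pathF'] finF0 obtain Q where
      Q: "finite Q" "card Q = Suc (card F')" "disjoint_lists Q"
      "\<And>q. q \<in> Q \<Longrightarrow> set_path E A B' q" "last ` F' \<subseteq> last ` Q"
      unfolding F'_def by blast
    have Qne: "q \<noteq> []" if "q \<in> Q" for q
      using Q(4)[OF that] unfolding set_path_def simple_path_def by blast
    have injQ: "inj_on last Q" using inj_on_last_disjoint_lists[OF Q(3)] Qne by blast
    have injF': "inj_on last F'"
      using inj_on_last_disjoint_lists[OF disF'] pathF' unfolding set_path_def simple_path_def by blast
    \<comment> \<open>Ends determine paths, so \<open>Q\<close> has exactly one end \<open>y\<close>
      besides those of \<open>F'\<close>; \<open>qx\<close> and \<open>qy\<close> are the paths
      ending in \<open>x\<close> and \<open>y\<close>.\<close>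
    have "card (last ` Q - last ` F') = card (last ` Q) - card (last ` F')"
      using Q(5) finF0 unfolding F'_def by (intro card_Diff_subset) auto
    then have "card (last ` Q - last ` F') = 1"
      using Q(2) card_image[OF injQ] card_image[OF injF'] by simp
    then obtain y where y: "last ` Q - last ` F' = {y}" by (auto simp: card_1_singleton_iff)
    have lastp': "last p' = x" by (simp add: p'_def)
    have xF': "x \<in> last ` F'" using lastp' by (simp add: F'_def)
    then have "x \<in> last ` Q" by (rule subsetD[OF Q(5)])
    then obtain qx where qx: "qx \<in> Q" "last qx = x" by (metis imageE)
    have "y \<in> last ` Q - last ` F'" using y by simp
    then have yQ: "y \<in> last ` Q" and yF': "y \<notin> last ` F'" by simp_all
    from yQ obtain qy where qy: "qy \<in> Q" "last qy = y" by (metis imageE)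
    have yx: "y \<noteq> x" using yF' xF' by metis
    then have qxy: "qx \<noteq> qy" using qx qy by auto
    \<comment> \<open>All other paths of \<open>Q\<close> end where members of \<open>F0\<close>
      end, so they are paths to \<open>B\<close> already and miss both remainders.\<close>
    define Q0 where "Q0 = Q - {qx, qy}"
    have Q0last: "last q \<in> last ` F0" if "q \<in> Q0" for q
    proof -
      have "last q \<noteq> x" "last q \<noteq> y"
        using that qx qy injQ unfolding Q0_def by (auto dest: inj_onD)
      moreover have "last q \<in> last ` Q" using that unfolding Q0_def by simp
      then have "last q \<in> last ` F' \<union> {y}" using y by (metis DiffI UnI1 UnI2)
      ultimately show ?thesis using lastp' by (simp add: F'_def)
    qed
    have F0last: "last ` F0 \<subseteq> last ` Q0"
    proof
      fix z assume z: "z \<in> last ` F0"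
      then have zF': "z \<in> last ` F'" by (simp add: F'_def)
      then have "z \<in> last ` Q" by (rule subsetD[OF Q(5)])
      then obtain q where q: "q \<in> Q" "last q = z" by (metis imageE)
      have "z \<noteq> x" using z F0p F0ne p(2) by (metis disjoint_iff imageE last_in_set)
      moreover have "z \<noteq> y" using zF' yF' by metis
      ultimately show "z \<in> last ` Q0" using q qx qy unfolding Q0_def by blast
    qed
    have blB': "set (butlast q) \<inter> B' = {}" if "q \<in> Q" for q
      using Q(4)[OF that] unfolding set_path_def by blast
    have setq: "set q = insert (last q) (set (butlast q))" if "q \<in> Q" for q
      using Qne[OF that] by (rule set_eq_insert_last_butlast)
    have Q0p: "set q \<inter> (set p2 \<union> set r2) = {}" if q: "q \<in> Q0" for q
    proof -
      have qQ: "q \<in> Q" using q Q0_def by auto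
      obtain q' where q': "q' \<in> F0" "last q = last q'" using Q0last[OF q] by (metis imageE)
      then have "last q \<in> set q'" using F0ne by simp
      then have "last q \<notin> set p2 \<union> set r2"
        using F0p[OF q'(1)] F0r[OF q'(1)] unfolding p_eq by auto
      then show ?thesis using blB'[OF qQ] setq[OF qQ] unfolding B'_def by auto
    qed
    have Q0path: "set_path E A B q" if "q \<in> Q0" for q
    proof -
      have "q \<in> Q" using that Q0_def by auto
      then have "set_path E A B' q" by (rule Q(4))
      moreover have "last ` F0 \<subseteq> B" using pth unfolding F0_def set_path_def by auto
      then have "last q \<in> B" using Q0last[OF that] by blast
      ultimately show ?thesis unfolding set_path_def B'_def by auto
    qed
    have Qdis: "set q \<inter> set q' = {}" if "q \<in> Q" "q' \<in> Q" "q \<noteq> q'" for q q'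
      using Q(3) that unfolding pairwise_def by blast
    have cardQ0: "Suc (Suc (card Q0)) = Suc (card F)"
    proof -
      have "Suc (card (Q - {qx})) = card Q" using card_Suc_Diff1 Q(1) qx(1) .
      moreover have "Suc (card (Q - {qx} - {qy})) = card (Q - {qx})"
        using Q(1) qy(1) qxy by (intro card_Suc_Diff1) auto
      moreover have "Q - {qx} - {qy} = Q0" unfolding Q0_def by auto
      ultimately show ?thesis using Q(2) cardF' by simp
    qed
    \<comment> \<open>It remains to make two disjoint paths to \<open>B\<close> out of
      \<open>qx\<close>, \<open>qy\<close> and the remainders, one of them ending where
      \<open>p\<close> ends.\<close>
    have assemble: ?thesis
      if u: "set_path E A B u" "set u \<subseteq> set qx \<union> set p2 \<union> set r2"
        and v: "set_path E A B v" "set v \<subseteq> set qy \<union> set p2 \<union> set r2"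
        and uv: "set u \<inter> set v = {}" "last p \<in> {last u, last v}" for u v
    proof (intro exI conjI ballI)
      have du: "set u \<inter> set q = {}" "set v \<inter> set q = {}" if "q \<in> Q0" for q
      proof -
        have "q \<in> Q" "q \<noteq> qx" "q \<noteq> qy" using that Q0_def by auto
        then have "set qx \<inter> set q = {}" "set qy \<inter> set q = {}"
          using Qdis[of qx q] Qdis[of qy q] qx qy by auto
        with Q0p[OF that] u(2) v(2) show "set u \<inter> set q = {}" "set v \<inter> set q = {}" by blast+
      qed
      have ne: "u \<noteq> []" "v \<noteq> []" using u v unfolding set_path_def simple_path_def by auto
      then have notin: "u \<notin> Q0" "v \<notin> Q0" "u \<noteq> v" using du uv(1) by force+
      show "finite (insert u (insert v Q0))" using Q(1) Q0_def by auto
      show "card (insert u (insert v Q0)) = Suc (card F)"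
        using notin Q(1) cardQ0 Q0_def by auto
      have "disjoint_lists Q0" using Q(3) Q0_def by (simp add: pairwise_mono)
      then show "disjoint_lists (insert u (insert v Q0))"
        using du uv(1) by (auto simp: pairwise_insert)
      show "set_path E A B q" if "q \<in> insert u (insert v Q0)" for q
        using that u v Q0path by auto
      show "last ` F \<subseteq> last ` insert u (insert v Q0)"
        using F0last uv(2) unfolding F_eq by auto
    qed
    have xqx: "set_path E A B' qx" and yqy: "set_path E A B' qy" using Q(4) qx qy by auto
    have dxy: "set qx \<inter> set qy = {}" using Qdis qx qy qxy by auto
    have hdx: "hd (qx @ l) \<in> A" "hd (qy @ l) \<in> A" for l
      using xqx yqy Qne qx qy unfolding set_path_def by auto
    have p2r2: "set p2 \<inter> set r2 = {}" using pr2 unfolding p_eq by auto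
    \<comment> \<open>If \<open>y\<close> is not on \<open>p2\<close>, then \<open>qx\<close> takes
      \<open>p2\<close>, and \<open>qy\<close> stops at \<open>y\<close> in \<open>B\<close> or
      continues along \<open>r2\<close>. If \<open>y\<close> is on \<open>p2\<close>, then
      \<open>qy\<close> finishes \<open>p2\<close> and \<open>qx\<close> takes
      \<open>r2\<close>.\<close>
    show ?thesis
    proof (cases "y \<in> set p2")
      case False
      have u: "set_path E A B (qx @ p2)"
        unfolding set_path_def
      proof (intro conjI)
        show "simple_path E (qx @ p2)"
          using xqx sp(2) qx(2) unfolding set_path_def B'_def
          by (intro simple_path_append) auto
        show "last (qx @ p2) \<in> B" using pp last_p p2 unfolding set_path_def by auto
        show "set (butlast (qx @ p2)) \<inter> B = {}"
          using p2 p2B setq[OF qx(1)] blB'[OF qx(1)] qx(2) xB unfolding B'_def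
          by (auto simp: butlast_append)
      qed (rule hdx)
      have dqy: "set (qx @ p2) \<inter> set qy = {}"
        using dxy setq[OF qy(1)] blB'[OF qy(1)] qy(2) False unfolding B'_def by auto
      have "\<exists>v. set_path E A B v \<and> set v \<subseteq> set qy \<union> set r2 \<and> set (qx @ p2) \<inter> set v = {}"
      proof (cases "y \<in> B")
        case True
        then have "set_path E A B qy" using yqy qy(2) unfolding set_path_def B'_def by auto
        then show ?thesis using dqy by blast
      next
        case yB: False
        have "y \<in> B'" using yqy qy(2) unfolding set_path_def by auto
        then have "y \<in> set r2" using False yB yx unfolding B'_def by auto
        then obtain r3 r4 where r2_eq: "r2 = r3 @ y # r4" by (meson split_list)
        have r4: "r4 \<noteq> []" using r2_eq yB r(3) last_r by auto
        have "set_path E A B (qy @ r4)"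
          unfolding set_path_def
        proof (intro conjI)
          have "simple_path E (y # r4)"
            using sp(3) simple_path_appendD(2)[of E "x # r3" y r4] unfolding r2_eq by simp
          then show "simple_path E (qy @ r4)"
            using yqy qy(2) unfolding set_path_def B'_def r2_eq
            by (intro simple_path_append) auto
          show "last (qy @ r4) \<in> B" using r(3) last_r r4 r2_eq by auto
          show "set (butlast (qy @ r4)) \<inter> B = {}"
            using r4 r2B setq[OF qy(1)] blB'[OF qy(1)] qy(2) yB unfolding B'_def r2_eq
            by (auto simp: butlast_append)
        qed (rule hdx)
        moreover have "set (qx @ p2) \<inter> set r4 = {}"
          using p2r2 setq[OF qx(1)] blB'[OF qx(1)] qx(2) dp(2) unfolding B'_def r2_eq by auto
        ultimately show ?thesis using dqy
          by (intro exI[of _ "qy @ r4"]) (auto simp: r2_eq)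
      qed
      then obtain v where v: "set_path E A B v" "set v \<subseteq> set qy \<union> set r2"
        "set (qx @ p2) \<inter> set v = {}" by blast
      have "last p \<in> {last (qx @ p2), last v}" using last_p p2 by simp
      moreover have "set (qx @ p2) \<subseteq> set qx \<union> set p2 \<union> set r2" by auto
      moreover have "set v \<subseteq> set qy \<union> set p2 \<union> set r2" using v(2) by auto
      ultimately show ?thesis using assemble[of "qx @ p2" v] u v by blast
    next
      case True
      then obtain p3 p4 where p2_eq: "p2 = p3 @ y # p4" by (meson split_list)
      have last_eq: "last p = last (qy @ p4)" using last_p(1) qy(2) unfolding p2_eq by simp
      have u: "set_path E A B (qx @ r2)"
        unfolding set_path_def
      proof (intro conjI)
        show "simple_path E (qx @ r2)"
          using xqx sp(3) qx(2) unfolding set_path_def B'_def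
          by (intro simple_path_append) auto
        show "last (qx @ r2) \<in> B" using r(3) last_r r2n by auto
        show "set (butlast (qx @ r2)) \<inter> B = {}"
          using r2n r2B setq[OF qx(1)] blB'[OF qx(1)] qx(2) xB unfolding B'_def
          by (auto simp: butlast_append)
      qed (rule hdx)
      have v: "set_path E A B (qy @ p4)"
        unfolding set_path_def
      proof (intro conjI)
        have "simple_path E (y # p4)"
          using sp(2) simple_path_appendD(2)[of E "x # p3" y p4] unfolding p2_eq by simp
        then show "simple_path E (qy @ p4)"
          using yqy qy(2) unfolding set_path_def B'_def p2_eq
          by (intro simple_path_append) auto
        show "last (qy @ p4) \<in> B" using pp unfolding set_path_def last_eq by simp
        have "set (butlast (y # p4)) \<inter> B = {}" using p2B unfolding p2_eq by (auto simp: butlast_append)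
        then show "set (butlast (qy @ p4)) \<inter> B = {}"
          using setq[OF qy(1)] blB'[OF qy(1)] qy(2) unfolding B'_def p2_eq
          by (auto simp: butlast_append)
      qed (rule hdx)
      have "set qx \<inter> set p4 = {}"
        using setq[OF qx(1)] blB'[OF qx(1)] qx(2) dp(1) unfolding B'_def p2_eq by auto
      moreover have "set r2 \<inter> set qy = {}"
        using p2r2 setq[OF qy(1)] blB'[OF qy(1)] qy(2) unfolding B'_def p2_eq by auto
      ultimately have "set (qx @ r2) \<inter> set (qy @ p4) = {}"
        using dxy p2r2 unfolding p2_eq by auto
      then show ?thesis using assemble[OF u _ v] last_eq unfolding p2_eq by auto
    qed
  qed
qed

text \<open>End nodes determine paths, so one additional path means exactly one additional
  end.\<close>

lemma menger_augment_one:
  assumes "finite F" "disjoint_lists F" "\<And>p. p \<in> F \<Longrightarrow> set_path E A B p"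
    and "\<And>S. finite S \<Longrightarrow> card S \<le> card F \<Longrightarrow>
      \<exists>p. simple_path E p \<and> hd p \<in> A \<and> last p \<in> B \<and> set p \<inter> S = {}"
  obtains Q y where "finite Q" "disjoint_lists Q" "\<And>p. p \<in> Q \<Longrightarrow> set_path E A B p"
    "y \<notin> last ` F" "last ` Q = insert y (last ` F)"
proof -
  obtain Q where Q: "finite Q" "card Q = Suc (card F)" "disjoint_lists Q"
    "\<forall>p \<in> Q. set_path E A B p" "last ` F \<subseteq> last ` Q"
    using menger_augment[OF assms] by blast
  have inj: "inj_on last Q" "inj_on last F"
    using Q(3,4) assms(2,3) unfolding set_path_def simple_path_def
    by (blast intro: inj_on_last_disjoint_lists)+
  have "card (last ` Q - last ` F) = card (last ` Q) - card (last ` F)"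
    using Q(5) assms(1) by (intro card_Diff_subset) auto
  then have "card (last ` Q - last ` F) = 1"
    using Q(2) card_image[OF inj(1)] card_image[OF inj(2)] by simp
  then obtain y where "last ` Q - last ` F = {y}" by (auto simp: card_1_singleton_iff)
  then have "y \<notin> last ` F" "last ` Q = insert y (last ` F)" using Q(5) by auto
  then show thesis using that Q by metis
qed

text \<open>Iterated augmentation; retaining the ends of \<open>F\<close> later forces a path of the
  fan to end in a prescribed node.\<close>

lemma menger_extend:
  assumes "finite F" "disjoint_lists F" "\<And>p. p \<in> F \<Longrightarrow> set_path E A B p" "card F \<le> n"
    and "\<And>S. finite S \<Longrightarrow> card S < n \<Longrightarrow>
      \<exists>p. simple_path E p \<and> hd p \<in> A \<and> last p \<in> B \<and> set p \<inter> S = {}"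
  shows "\<exists>Q. finite Q \<and> card Q = n \<and> disjoint_lists Q \<and>
    (\<forall>p \<in> Q. set_path E A B p) \<and> last ` F \<subseteq> last ` Q"
  using \<open>card F \<le> n\<close>
proof (induction rule: dec_induct)
  case base
  then show ?case using assms(1-3) by blast
next
  case (step m)
  then obtain Q where Q: "finite Q" "card Q = m" "disjoint_lists Q"
    "\<And>p. p \<in> Q \<Longrightarrow> set_path E A B p" "last ` F \<subseteq> last ` Q" by blast
  have "\<exists>Q'. finite Q' \<and> card Q' = Suc (card Q) \<and> disjoint_lists Q' \<and>
    (\<forall>p \<in> Q'. set_path E A B p) \<and> last ` Q \<subseteq> last ` Q'"
    using Q step.hyps assms(5) by (intro menger_augment) auto
  then obtain Q' where "finite Q'" "card Q' = Suc (card Q)" "disjoint_lists Q'"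
    "\<forall>p \<in> Q'. set_path E A B p" "last ` Q \<subseteq> last ` Q'" by blast
  then show ?case using Q(2,5) by (intro exI[of _ Q']) auto
qed

section \<open>The subdivided graph\<close>

context graph
begin

text \<open>
  Nodes of the subdivision of \<open>G\<close> are encoded as vertex sets: \<open>{v}\<close> is the vertex \<open>v\<close>, a doubleton is
  the midpoint of an edge, and adjacency is proper inclusion. The vertices in \<open>Z\<close> are deleted, the
  midpoints of their edges are not.
\<close>

definition nodes :: "'a set \<Rightarrow> 'a set set" where
  "nodes Z = (\<lambda>v. {v}) ` (verts G - Z) \<union> {{u, v} | u v. u \<rightarrow> v}"

definition adj :: "'a set \<Rightarrow> 'a set \<Rightarrow> 'a set \<Rightarrow> bool" where
  "adj Z X Y \<longleftrightarrow> X \<in> nodes Z \<and> Y \<in> nodes Z \<and> (X \<subset> Y \<or> Y \<subset> X)"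

definition star :: "'a \<Rightarrow> 'a set set" where
  "star v = {{v, w} | w. v \<rightarrow> w}"

lemma arc_neq: "u \<rightarrow> v \<Longrightarrow> u \<noteq> v"
  using no_loops by (auto simp: arcs_ends_conv)

lemma symp_adj: "symp (adj Z)"
  by (auto simp: symp_def adj_def)

lemma star_subset_nodes: "star v \<subseteq> nodes Z"
  by (auto simp: star_def nodes_def)

lemma singleton_in_nodes_iff: "{v} \<in> nodes Z \<longleftrightarrow> v \<in> verts G \<and> v \<notin> Z"
  by (auto simp: nodes_def singleton_insert_inj_eq dest: arc_neq)

text \<open>Neither two midpoints nor two singletons are properly included in each other, so
  adjacency is incidence of a vertex outside \<open>Z\<close> with an edge.\<close>

lemma adj_cases:
  assumes "adj Z X Y"
  obtains x y where "X = {x}" "Y = {x, y}" "x \<rightarrow> y" "x \<notin> Z"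
    | x y where "Y = {x}" "X = {x, y}" "x \<rightarrow> y" "x \<notin> Z"
proof -
  have *: "\<exists>x y. X = {x} \<and> Y = {x, y} \<and> x \<rightarrow> y \<and> x \<notin> Z"
    if XY: "X \<in> nodes Z" "Y \<in> nodes Z" "X \<subset> Y" for X Y
  proof -
    from XY have "\<not> (\<exists>v. Y = {v})" by (auto simp: nodes_def psubset_eq dest: arc_neq)
    then obtain u v where Y: "Y = {u, v}" "u \<rightarrow> v" using XY(2) unfolding nodes_def by blast
    have "X = {u} \<or> X = {v}"
    proof (cases "X \<in> (\<lambda>v. {v}) ` (verts G - Z)")
      case True then show ?thesis using XY(3) Y by auto
    next
      case False
      then obtain u' v' where "X = {u', v'}" "u' \<rightarrow> v'" using XY(1) unfolding nodes_def by blast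
      then show ?thesis using XY(3) Y arc_neq by blast
    qed
    then show ?thesis using XY(1) Y graph_symmetric singleton_in_nodes_iff by (metis insert_commute)
  qed
  show thesis using assms * that unfolding adj_def by metis
qed

lemma adj_antimono: "Z' \<subseteq> Z \<Longrightarrow> adj Z X Y \<Longrightarrow> adj Z' X Y"
  unfolding adj_def nodes_def by blast

text \<open>A one-node list satisfies \<open>successively\<close> vacuously, hence the condition on
  the head.\<close>

lemma path_subset_nodes:
  assumes "simple_path (adj Z) p" "hd p \<in> nodes Z"
  shows "set p \<subseteq> nodes Z"
proof -
  have "successively (adj Z) p \<Longrightarrow> hd p \<in> nodes Z \<Longrightarrow> p \<noteq> [] \<Longrightarrow> set p \<subseteq> nodes Z"
  proof (induction p rule: induct_list012)
    case (3 x y zs)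
    then show ?case by (auto simp: adj_def)
  qed auto
  then show ?thesis using assms unfolding simple_path_def by auto
qed

text \<open>With \<open>w\<close> deleted, the midpoint of an edge at \<open>w\<close> has at most
  one neighbour, so a path cannot pass through it. If it is the first node, it also lies in
  \<open>star u\<close>; it is then the midpoint between \<open>u\<close> and \<open>w\<close>,
  which has no neighbour at all.\<close>

lemma star_dead_end:
  assumes p: "simple_path (adj Z) p" "hd p \<in> star u" and Z: "u \<in> Z" "w \<in> Z" "u \<noteq> w"
  shows "set (butlast p) \<inter> star w = {}"
proof (rule ccontr)
  assume "set (butlast p) \<inter> star w \<noteq> {}"
  then obtain X where X: "X \<in> set (butlast p)" "X \<in> star w" by blast
  then obtain l r0 where l: "butlast p = l @ X # r0" by (meson split_list)
  moreover have "p \<noteq> []" using p(1) simple_path_def by auto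
  ultimately have "p = l @ X # (r0 @ [last p])" by (metis append.assoc append_Cons append_butlast_last_id)
  then obtain Y r where p_eq: "p = l @ X # Y # r" by (cases r0) auto
  have nb: "\<exists>v. X = {w, v} \<and> V = {v} \<and> v \<notin> Z" if "adj Z X V" for V
    using that
  proof (cases rule: adj_cases)
    case (1 x y)
    then show ?thesis using X(2) arc_neq unfolding star_def by auto
  next
    case (2 x y)
    then show ?thesis using X(2) Z unfolding star_def by (auto simp: doubleton_eq_iff)
  qed
  have "adj Z X Y" using p(1) p_eq unfolding simple_path_def by (auto simp: successively_append_iff)
  from nb[OF this] obtain v where v: "X = {w, v}" "Y = {v}" "v \<notin> Z" by blast
  show False
  proof (cases "l = []")
    case True
    then have "X \<in> star u" using p(2) p_eq by simp
    then show False using v Z unfolding star_def by (auto simp: doubleton_eq_iff)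
  next
    case False
    then have "adj Z (last l) X" using p(1) p_eq unfolding simple_path_def
      by (auto simp: successively_append_iff)
    then have "adj Z X (last l)" using symp_adj by (metis sympD)
    from nb[OF this] have "last l = Y" using v by (auto simp: doubleton_eq_iff)
    then have "Y \<in> set l" using False last_in_set by metis
    then show False using p(1) p_eq unfolding simple_path_def by auto
  qed
qed

section \<open>Connectivity carried over to the subdivision\<close>

text \<open>The definition of \<open>connected\<close> passes to a symmetric closure, which adds no
  arcs because \<open>G\<close> is symmetric already.\<close>

lemma k_connected_reach:
  assumes "k_connected k G" "D \<subseteq> verts G" "card D < k" "u \<in> verts G - D" "w \<in> verts G - D"
  shows "(\<lambda>x y. x \<rightarrow> y \<and> x \<notin> D \<and> y \<notin> D)\<^sup>*\<^sup>* u w"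
proof -
  let ?H = "G \<restriction> (verts G - D)"
  have "connected ?H" using assms unfolding k_connected_def by blast
  then have "(u, w) \<in> rtrancl_on (verts (with_proj (mk_symmetric ?H))) (arcs_ends (with_proj (mk_symmetric ?H)))"
    using assms(4,5) unfolding connected_def strongly_connected_def reachable_def by auto
  then show ?thesis
  proof (induction rule: rtrancl_on_induct)
    case (step x y)
    then have "x \<rightarrow> y \<and> x \<notin> D \<and> y \<notin> D"
      using sym_arcs unfolding symmetric_def sym_def
      by (auto simp: parcs_mk_symmetric arcs_ends_conv)
    then show ?case by (rule rtranclp.rtrancl_into_rtrancl[OF step.IH])
  qed auto
qed

text \<open>
  Each subdivided edge in \<open>S\<close> other than \<open>{u, w}\<close> may be replaced by an end different from \<open>u\<close> and
  \<open>w\<close>; if \<open>{u, w}\<close> itself lies in \<open>S\<close>, one goes through a third vertex \<open>z\<close> instead, avoiding first \<open>w\<close>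
  and then \<open>u\<close>.
\<close>

lemma k_connected_reach_avoiding:
  fixes S :: "'a set set"
  assumes k: "k_connected k G" and S: "finite S" "card S < k"
    and uw: "u \<in> verts G" "w \<in> verts G" "u \<noteq> w" "{u} \<notin> S" "{w} \<notin> S"
  shows "(\<lambda>x y. x \<rightarrow> y \<and> {x} \<notin> S \<and> {y} \<notin> S \<and> {x, y} \<notin> S)\<^sup>*\<^sup>* u w"
    (is "?W\<^sup>*\<^sup>* u w")
proof -
  define f where "f X = (SOME v. v \<in> X \<and> v \<notin> {u, w})" for X :: "'a set"
  have f: "f X \<in> X \<and> f X \<notin> {u, w}" if "\<not> X \<subseteq> {u, w}" for X
    unfolding f_def using that by (intro someI_ex[of "\<lambda>v. v \<in> X \<and> v \<notin> {u, w}"]) blast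
  define D where "D = f ` {X \<in> S. \<not> X \<subseteq> {u, w}} \<inter> verts G"
  have D: "D \<subseteq> verts G" "u \<notin> D" "w \<notin> D" using f unfolding D_def by auto
  have Dmem: "f X \<in> X \<inter> D" if "X \<in> S" "\<not> X \<subseteq> {u, w}" "X \<subseteq> verts G" for X
    using f[of X] that unfolding D_def by blast
  have finD: "finite D" using D(1) finite_verts finite_subset by blast
  have "card D \<le> card (f ` {X \<in> S. \<not> X \<subseteq> {u, w}})"
    unfolding D_def using S(1) by (intro card_mono) auto
  also have "\<dots> \<le> card {X \<in> S. \<not> X \<subseteq> {u, w}}" using S(1) by (intro card_image_le) simp
  finally have card_D: "card D \<le> card {X \<in> S. \<not> X \<subseteq> {u, w}}" .
  \<comment> \<open>The exception is the edge \<open>{u, w}\<close>, which has no representative in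
    \<open>D\<close>.\<close>
  have W: "?W x y" if "x \<rightarrow> y" "x \<notin> D" "y \<notin> D" "{u, w} \<notin> S \<or> u \<notin> {x, y} \<or> w \<notin> {x, y}" for x y
  proof -
    have V: "x \<in> verts G" "y \<in> verts G" using that(1) by (auto simp: arcs_ends_conv)
    have 1: "{v} \<notin> S" if "v \<in> verts G" "v \<notin> D" for v
    proof
      assume v: "{v} \<in> S"
      then have "\<not> {v} \<subseteq> {u, w}" using uw by auto
      with Dmem[of "{v}"] v that show False by auto
    qed
    have "{x, y} \<notin> S"
    proof
      assume s: "{x, y} \<in> S"
      have "{x, y} = {u, w}" if "{x, y} \<subseteq> {u, w}" using that arc_neq[OF \<open>x \<rightarrow> y\<close>] by auto
      then have "\<not> {x, y} \<subseteq> {u, w}" using that(4) s by (metis insertCI)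
      with Dmem[OF s] V that(2,3) show False by auto
    qed
    then show ?thesis using 1 that V by auto
  qed
  show ?thesis
  proof (cases "{u, w} \<in> S")
    case False
    note card_D
    also have "card {X \<in> S. \<not> X \<subseteq> {u, w}} \<le> card S" using S(1) by (intro card_mono) auto
    finally have "(\<lambda>x y. x \<rightarrow> y \<and> x \<notin> D \<and> y \<notin> D)\<^sup>*\<^sup>* u w"
      using k_connected_reach[OF k D(1)] S uw D by auto
    then show ?thesis by (rule rtranclp_weaken) (rule W, use False in auto)
  next
    case True
    note card_D
    also have "card {X \<in> S. \<not> X \<subseteq> {u, w}} \<le> card (S - {{u, w}})" using S(1) by (intro card_mono) auto
    \<comment> \<open>The unrepresented element \<open>{u, w}\<close> makes \<open>D\<close> smaller
      than \<open>S\<close>, which leaves room to delete \<open>w\<close> or \<open>u\<close> as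
      well. Since \<open>G\<close> has more than \<open>k\<close> vertices, a third vertex
      \<open>z\<close> exists.\<close>
    finally have "card D < card S" using S True by (metis card_Diff1_less order.strict_trans1)
    then have cD: "Suc (card D) < k" using S by simp
    have "card (insert u (insert w D)) < card (verts G)"
      using cD k D finD uw unfolding k_connected_def by simp
    then have "\<not> verts G \<subseteq> insert u (insert w D)"
      using finD by (metis card_mono finite_insert not_less)
    then obtain z where z: "z \<in> verts G" "z \<noteq> u" "z \<noteq> w" "z \<notin> D" by blast
    have "(\<lambda>x y. x \<rightarrow> y \<and> x \<notin> insert w D \<and> y \<notin> insert w D)\<^sup>*\<^sup>* u z"
      using D uw z cD finD by (intro k_connected_reach[OF k]) auto
    then have "?W\<^sup>*\<^sup>* u z" by (rule rtranclp_weaken) (rule W, auto)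
    moreover have "(\<lambda>x y. x \<rightarrow> y \<and> x \<notin> insert u D \<and> y \<notin> insert u D)\<^sup>*\<^sup>* z w"
      using D uw z cD finD by (intro k_connected_reach[OF k]) auto
    then have "?W\<^sup>*\<^sup>* z w" by (rule rtranclp_weaken) (rule W, auto)
    ultimately show ?thesis by (rule rtranclp_trans)
  qed
qed

text \<open>Passing an inner vertex \<open>y\<close> takes two steps, to \<open>{y}\<close> and to
  the next midpoint. The walk starts and ends at midpoints, so the two end vertices may belong to
  \<open>Z\<close>.\<close>

lemma vertex_path_imp_node_reach:
  assumes "successively (\<lambda>x y. x \<rightarrow> y \<and> {x} \<notin> S \<and> {y} \<notin> S \<and> {x, y} \<notin> S) (x # y # p)"
    and "last (y # p) = w" "set (butlast (y # p)) \<inter> Z = {}"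
  shows "\<exists>e \<in> star w. (\<lambda>X Y. adj Z X Y \<and> Y \<notin> S)\<^sup>*\<^sup>* {x, y} e"
  using assms
proof (induction p arbitrary: x y)
  case Nil
  then have "{x, y} \<in> star w" unfolding star_def by (auto simp: insert_commute dest: graph_symmetric)
  then show ?case by blast
next
  case (Cons z p)
  then obtain e where e: "e \<in> star w" "(\<lambda>X Y. adj Z X Y \<and> Y \<notin> S)\<^sup>*\<^sup>* {y, z} e"
    by (auto split: if_splits)
  have xy: "x \<rightarrow> y" "y \<rightarrow> z" "{y} \<notin> S" "{y, z} \<notin> S" "y \<notin> Z" using Cons.prems by auto
  then have "y \<in> verts G" "x \<noteq> y" "y \<noteq> z" by (blast intro: adj_in_verts dest: arc_neq)+
  then have "{y} \<in> nodes Z" "{y} \<subset> {x, y}" "{y} \<subset> {y, z}"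
    using xy(5) by (auto simp: singleton_in_nodes_iff)
  moreover have "{x, y} \<in> star x" "{y, z} \<in> star y" using xy unfolding star_def by blast+
  then have "{x, y} \<in> nodes Z" "{y, z} \<in> nodes Z" using star_subset_nodes by blast+
  ultimately have "adj Z {x, y} {y}" "adj Z {y} {y, z}" unfolding adj_def by auto
  then show ?case using e xy(3,4)
    by (intro bexI[of _ e] converse_rtranclp_into_rtranclp[of _ "{x, y}" "{y}"]
        converse_rtranclp_into_rtranclp[of _ "{y}" "{y, z}"]) auto
qed

text \<open>Deleted vertices other than \<open>u\<close> and \<open>w\<close> are treated as further
  forbidden singletons, each costing one unit of connectivity. Deleting \<open>u\<close> and
  \<open>w\<close> is free, since the path runs between midpoints of their edges.\<close>

lemma k_connected_node_path:
  assumes k: "k_connected k G" and S: "finite S" "finite Z" "card S + card (Z - {u, w}) < k"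
    and uw: "u \<in> verts G" "w \<in> verts G" "u \<noteq> w" "u \<in> Z" "w \<in> Z"
  shows "\<exists>q. simple_path (adj Z) q \<and> hd q \<in> star u \<and> last q \<in> star w \<and> set q \<inter> S = {}"
proof -
  \<comment> \<open>\<open>{u}\<close> and \<open>{w}\<close> are taken out so that the vertex path
    can use its own ends; the node path avoids them because they are not nodes once deleted.\<close>
  define S' where "S' = (S - {{u}, {w}}) \<union> (\<lambda>z. {z}) ` (Z - {u, w})"
  let ?W = "\<lambda>x y. x \<rightarrow> y \<and> {x} \<notin> S' \<and> {y} \<notin> S' \<and> {x, y} \<notin> S'"
  have "card S' \<le> card (S - {{u}, {w}}) + card ((\<lambda>z. {z}) ` (Z - {u, w}))"
    unfolding S'_def by (rule card_Un_le)
  also have "\<dots> \<le> card S + card (Z - {u, w})"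
    using S by (intro add_mono card_mono card_image_le) auto
  finally have "card S' < k" using S by simp
  moreover have "finite S'" "{u} \<notin> S'" "{w} \<notin> S'" unfolding S'_def using S by auto
  ultimately have "?W\<^sup>*\<^sup>* u w" using k_connected_reach_avoiding[OF k] uw by blast
  then obtain p where p: "simple_path ?W p" "hd p = u" "last p = w"
    using rtranclp_imp_simple_path[of ?W u w] by blast
  then obtain y p' where p_eq: "p = u # y # p'"
    using uw(3) unfolding simple_path_def by (cases p; cases "tl p") auto
  have succ: "successively ?W (u # y # p')" using p(1) unfolding p_eq simple_path_def by blast
  have inner: "set (butlast (y # p')) \<inter> Z = {}"
  proof (rule ccontr)
    assume "set (butlast (y # p')) \<inter> Z \<noteq> {}"
    then obtain v where v: "v \<in> set (butlast (y # p'))" "v \<in> Z" by blast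
    have "v \<noteq> u" using v p(1) unfolding p_eq simple_path_def by (auto dest: in_set_butlastD split: if_splits)
    moreover have "v \<noteq> w"
    proof -
      have "distinct (butlast (y # p') @ [w])"
        using p unfolding p_eq simple_path_def by (metis append_butlast_last_id distinct.simps(2) last_ConsR list.discI)
      then show ?thesis using v by auto
    qed
    ultimately have "{v} \<in> S'" using v unfolding S'_def by auto
    moreover have "{v} \<notin> S'"
    proof (rule successively_all[OF succ, of "\<lambda>v. {v} \<notin> S'"])
      show "v \<in> set (u # y # p')" using in_set_butlastD[OF v(1)] by simp
    qed (use \<open>{u} \<notin> S'\<close> in auto)
    ultimately show False by blast
  qed
  have "last (y # p') = w" using p p_eq by simp
  from vertex_path_imp_node_reach[OF succ this inner] obtain e where
    e: "e \<in> star w" "(\<lambda>X Y. adj Z X Y \<and> Y \<notin> S')\<^sup>*\<^sup>* {u, y} e" by (rule bexE)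
  from rtranclp_imp_simple_path[OF e(2)] obtain q where
    q: "simple_path (\<lambda>X Y. adj Z X Y \<and> Y \<notin> S') q" "hd q = {u, y}" "last q = e"
    by (elim exE conjE)
  have uy: "{u, y} \<in> star u" "{u, y} \<notin> S'" using succ unfolding star_def by auto
  have sq: "simple_path (adj Z) q" 
    using q(1) successively_mono[of "\<lambda>X Y. adj Z X Y \<and> Y \<notin> S'" q "adj Z"]
    unfolding simple_path_def by simp
  have "X \<notin> S'" if "X \<in> set q" for X
  proof (rule successively_all[of "\<lambda>X Y. adj Z X Y \<and> Y \<notin> S'" q "\<lambda>X. X \<notin> S'"])
    show "successively (\<lambda>X Y. adj Z X Y \<and> Y \<notin> S') q" using q(1) unfolding simple_path_def by simp
  qed (use q(2) uy that in auto)
  moreover have "set q \<subseteq> nodes Z" using path_subset_nodes[OF sq] q(2) uy star_subset_nodes by auto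
  then have "{u} \<notin> set q" "{w} \<notin> set q" using uw singleton_in_nodes_iff by blast+
  ultimately have "set q \<inter> S = {}" unfolding S'_def by blast
  then show ?thesis using sq q uy e by auto
qed

section \<open>Links and the vertex paths they represent\<close>

text \<open>The list runs from midpoint to midpoint and omits terminals in \<open>Z\<close>, so
  links with a common terminal can be disjoint. A single edge becomes the one-node list of its
  midpoint.\<close>

definition link :: "'a set \<Rightarrow> 'a \<Rightarrow> 'a \<Rightarrow> 'a set list \<Rightarrow> bool" where
  "link Z u w p \<longleftrightarrow> simple_path (adj Z) p \<and> hd p \<in> star u \<and> last p \<in> star w"

lemma link_rev: "link Z u w p \<Longrightarrow> link Z w u (rev p)"
  unfolding link_def using simple_path_rev[OF symp_adj, of Z p] by (simp add: hd_rev last_rev)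

lemma link_subset_nodes: "link Z u w p \<Longrightarrow> set p \<subseteq> nodes Z"
  unfolding link_def using path_subset_nodes star_subset_nodes by blast

text \<open>Along \<open>q\<close>, every vertex in \<open>ok\<close> is shown reachable from
  \<open>u\<close> by edges whose midpoints lie on \<open>q\<close>; a simple path is then
  extracted. Its inner vertices and edges come from \<open>q\<close>, which carries disjointness
  over.\<close>

lemma link_imp_vpath:
  assumes q: "link Z u w q" and uw: "u \<in> verts G" "u \<in> Z" "w \<in> Z"
  shows "\<exists>p. vpath p G \<and> hd p = u \<and> last p = w \<and> (\<forall>v \<in> internal_verts p. {v} \<in> set q) \<and>
    successively (\<lambda>x y. {x, y} \<in> set q) p"
proof -
  define ok where "ok = insert u (insert w {v. {v} \<in> set q})"
  define W where "W x y \<longleftrightarrow> x \<rightarrow> y \<and> {x, y} \<in> set q \<and> x \<in> ok \<and> y \<in> ok" for x y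
  have q': "q \<noteq> []" "successively (adj Z) q" "hd q \<in> star u" "last q \<in> star w"
    using q unfolding link_def simple_path_def by auto
  \<comment> \<open>Induction over the prefixes of \<open>q\<close>: at a new midpoint, its other
    end is reached from the vertex just before it.\<close>
  have "\<forall>X \<in> set q1. \<forall>x \<in> X \<inter> ok. W\<^sup>*\<^sup>* u x" if "q = q1 @ q2" "q1 \<noteq> []" for q1 q2
    using that
  proof (induction q1 arbitrary: q2 rule: rev_induct)
    case (snoc Y q1)
    show ?case
    proof (cases "q1 = []")
      case True
      then obtain v where v: "Y = {u, v}" "u \<rightarrow> v" using q'(3) snoc.prems unfolding star_def by auto
      have "Y \<in> set q" using snoc.prems by simp
      have "W\<^sup>*\<^sup>* u v" if "v \<in> ok"
        using that v \<open>Y \<in> set q\<close> by (intro r_into_rtranclp) (auto simp: W_def ok_def)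
      then show ?thesis using v True by auto
    next
      case False
      then have IH: "\<forall>X \<in> set q1. \<forall>x \<in> X \<inter> ok. W\<^sup>*\<^sup>* u x" using snoc by simp
      have "adj Z (last q1) Y" using q'(2) False unfolding snoc.prems(1)
        by (auto simp: successively_append_iff)
      then have "W\<^sup>*\<^sup>* u y" if "y \<in> Y \<inter> ok" for y
      proof (cases rule: adj_cases)
        case (1 x z)
        have x: "x \<in> ok" "W\<^sup>*\<^sup>* u x"
        proof -
          have "{x} \<in> set q1" using 1 False last_in_set by metis
          then show "x \<in> ok" unfolding ok_def snoc.prems(1) by simp
          then show "W\<^sup>*\<^sup>* u x" using IH \<open>{x} \<in> set q1\<close> by auto
        qed
        show ?thesis
        proof (cases "y = x")
          case False
          then have "y = z" using that 1 by auto
          then have "W x y" using 1 x that snoc.prems(1) unfolding W_def by auto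
          then show ?thesis using x(2) by (rule rtranclp.rtrancl_into_rtrancl[rotated])
        qed (use x in simp)
      next
        case (2 x z)
        then have "y \<in> last q1 \<inter> ok" using that by auto
        then show ?thesis using IH last_in_set[OF False] by blast
      qed
      then show ?thesis using IH by auto
    qed
  qed simp
  from this[of q "[]"] have "\<forall>X \<in> set q. \<forall>x \<in> X \<inter> ok. W\<^sup>*\<^sup>* u x" using q'(1) by simp
  moreover have "last q \<in> set q" "w \<in> last q" "w \<in> ok" using q' unfolding star_def ok_def by auto
  ultimately have "W\<^sup>*\<^sup>* u w" by blast
  from rtranclp_imp_simple_path[OF this] obtain p where
    p: "simple_path W p" "hd p = u" "last p = w" by (elim exE conjE)
  have p': "p \<noteq> []" "distinct p" "successively W p" using p(1) unfolding simple_path_def by auto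
  have "set (vwalk_arcs p) \<subseteq> arcs_ends G"
    using p'(3) by (induction p rule: vwalk_arcs.induct) (auto simp: W_def)
  moreover have "x \<in> verts G \<and> x \<in> ok" if "x \<in> set p" for x
  proof (rule successively_all[OF p'(3) _ _ that])
    show "y \<in> verts G \<and> y \<in> ok" if "W x y" for x y
      using that unfolding W_def by (auto simp: arcs_ends_conv)
    show "hd p \<in> verts G \<and> hd p \<in> ok" using p(2) uw ok_def by auto
  qed
  note inset = this
  ultimately have "vpath p G" using p' by (auto simp: vpath_def vwalk_def)
  moreover have "{v} \<in> set q" if "v \<in> internal_verts p" for v
  proof -
    have "tl p \<noteq> []" using that unfolding internal_verts_def by auto
    then have p_eq: "p = u # butlast (tl p) @ [w]"
      using p p' by (metis append_butlast_last_id last_tl list.collapse)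
    have "distinct (u # butlast (tl p) @ [w])" using p'(2) p_eq by metis
    moreover have "v \<in> set (u # butlast (tl p) @ [w])" using that unfolding internal_verts_def by simp
    then have "v \<in> set p" using p_eq by metis
    ultimately have "v \<noteq> u" "v \<noteq> w" "v \<in> set p" using that unfolding internal_verts_def by auto
    then show ?thesis using inset unfolding ok_def by auto
  qed
  moreover have "successively (\<lambda>x y. {x, y} \<in> set q) p"
    using p'(3) by (rule successively_mono) (auto simp: W_def)
  ultimately show ?thesis using p by blast
qed

section \<open>Systems of paths between three terminals\<close>

text \<open>\<open>P\<close> and \<open>Q\<close> both start at \<open>c\<close> and so form a fan
  that can be augmented. The classes are required disjoint as sets because \<open>pairwise\<close>
  compares only different lists.\<close>

definition triad :: "'a \<Rightarrow> 'a \<Rightarrow> 'a \<Rightarrow> nat \<Rightarrow> nat \<Rightarrow> nat \<Rightarrow> bool" where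
  "triad a b c m n l \<longleftrightarrow> (\<exists>R P Q. finite R \<and> finite P \<and> finite Q \<and>
     card R = m \<and> card P = n \<and> card Q = l \<and>
     R \<inter> (P \<union> Q) = {} \<and> P \<inter> Q = {} \<and> disjoint_lists (R \<union> P \<union> Q) \<and>
     (\<forall>p \<in> R. link {a, b, c} a b p) \<and> (\<forall>p \<in> P. link {a, b, c} c b p) \<and>
     (\<forall>p \<in> Q. link {a, b, c} c a p))"

lemma triadE:
  assumes "triad a b c m n l"
  obtains R P Q where "finite R" "finite P" "finite Q" "card R = m" "card P = n" "card Q = l"
    "R \<inter> (P \<union> Q) = {}" "P \<inter> Q = {}" "disjoint_lists (R \<union> P \<union> Q)"
    "\<forall>p \<in> R. link {a, b, c} a b p" "\<forall>p \<in> P. link {a, b, c} c b p"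
    "\<forall>p \<in> Q. link {a, b, c} c a p"
  using assms unfolding triad_def by (elim exE conjE)

lemma link_nonempty: "link Z u w p \<Longrightarrow> p \<noteq> []"
  by (simp add: link_def simple_path_def)

text \<open>Exchanging \<open>a\<close> and \<open>b\<close> exchanges \<open>P\<close> and
  \<open>Q\<close>; the paths of \<open>R\<close> are reversed.\<close>

lemma triad_swap:
  assumes "triad a b c m n l"
  shows "triad b a c m l n"
proof -
  obtain R P Q where fin: "finite R" "finite P" "finite Q"
    and cd: "card R = m" "card P = n" "card Q = l"
    and dj: "R \<inter> (P \<union> Q) = {}" "P \<inter> Q = {}" "disjoint_lists (R \<union> P \<union> Q)"
    and links: "\<forall>p \<in> R. link {a, b, c} a b p" "\<forall>p \<in> P. link {a, b, c} c b p" "\<forall>p \<in> Q. link {a, b, c} c a p"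
    using assms by (rule triadE)
  note lk = links[THEN bspec]
  have D: "set p \<inter> set q = {}" if "p \<in> R \<union> P \<union> Q" "q \<in> R \<union> P \<union> Q" "p \<noteq> q" for p q
    using dj(3) that unfolding pairwise_def by blast
  have RPQ: "set (rev p) \<inter> set q = {}" if "p \<in> R" "q \<in> Q \<union> P" for p q
    using D[of p q] dj(1) that by auto
  have disj: "rev ` R \<inter> (Q \<union> P) = {}"
  proof -
    have "rev p \<notin> Q \<union> P" if "p \<in> R" for p
      using RPQ[OF that, of "rev p"] link_nonempty[OF lk(1)[OF that]] by auto
    then show ?thesis by auto
  qed
  have "disjoint_lists (rev ` R \<union> Q \<union> P)"
    unfolding pairwise_def
  proof (intro ballI impI)
    fix p q assume pq: "p \<in> rev ` R \<union> Q \<union> P" "q \<in> rev ` R \<union> Q \<union> P" "p \<noteq> q"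
    \<comment> \<open>\<open>f\<close> undoes the reversal, so disjointness is inherited from the
      original lists.\<close>
    define f where "f x = (if x \<in> rev ` R then rev x else x)" for x
    have f: "f x \<in> R \<union> P \<union> Q" "set (f x) = set x" if "x \<in> rev ` R \<union> Q \<union> P" for x
      using that unfolding f_def by auto
    have "f p \<noteq> f q"
      using pq dj(1) unfolding f_def by auto
    then show "set p \<inter> set q = {}" using D[of "f p" "f q"] f pq by auto
  qed
  moreover have "\<forall>p \<in> rev ` R. link {a, b, c} b a p" using link_rev lk(1) by blast
  moreover have "card (rev ` R) = m" using cd(1) by (simp add: card_image)
  moreover have "Q \<inter> P = {}" using dj(2) by blast
  ultimately show ?thesis
    unfolding triad_def insert_commute[of b a] using fin cd(2,3) disj links(2,3)
    by (intro exI[of _ "rev ` R"] exI[of _ Q] exI[of _ P] conjI) simp_all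
qed

text \<open>
  Augment the fan of paths leaving \<open>c\<close>, where a new path may also end on a path joining \<open>a\<close> and \<open>b\<close>.
  In that case the part of the latter path up to \<open>a\<close> completes the new path. The hypothesis \<open>m > 0\<close>
  leaves room for deleting \<open>b\<close> in the connectivity argument.
\<close>

lemma triad_step:
  assumes k: "k_connected k G" and V: "a \<in> verts G" "b \<in> verts G" "c \<in> verts G"
    and ne: "a \<noteq> b" "b \<noteq> c" "c \<noteq> a"
    and t: "triad a b c (Suc m) n l" and m: "m > 0" "Suc m + n + l \<le> k"
  shows "triad a b c m n (Suc l)"
proof -
  let ?Z = "{a, b, c}"
  obtain R P Q where fin: "finite R" "finite P" "finite Q"
    and cd: "card R = Suc m" "card P = n" "card Q = l"
    and dj: "R \<inter> (P \<union> Q) = {}" "P \<inter> Q = {}" "disjoint_lists (R \<union> P \<union> Q)"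
    and links: "\<forall>p \<in> R. link ?Z a b p" "\<forall>p \<in> P. link ?Z c b p" "\<forall>p \<in> Q. link ?Z c a p"
    using t by (rule triadE)
  note lk = links[THEN bspec]
  define F where "F = P \<union> Q"
  have D: "set p \<inter> set q = {}" if "p \<in> R \<union> F" "q \<in> R \<union> F" "p \<noteq> q" for p q
    using dj(3) that unfolding pairwise_def F_def by blast
  have RF: "set p \<inter> set q = {}" if "p \<in> R" "q \<in> F" for p q
    using D[of p q] dj(1) that unfolding F_def by blast
  \<comment> \<open>The old ends belong to the target set, so that augmentation preserves them and
    with them the numbers of paths in both classes.\<close>
  define T where "T = \<Union>(set ` R) \<union> last ` F \<union> star a"
  have linkF: "simple_path (adj ?Z) p" "hd p \<in> star c" "p \<noteq> []" if "p \<in> F" for p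
    using lk(2,3) that link_nonempty unfolding F_def link_def by blast+
  have pathF: "set_path (adj ?Z) (star c) T p" if p: "p \<in> F" for p
  proof -
    have "set (butlast p) \<inter> star a = {}" using star_dead_end[OF linkF(1,2)[OF p]] ne by auto
    moreover have "set (butlast p) \<inter> \<Union>(set ` R) = {}" using RF p by (fastforce dest: in_set_butlastD)
    moreover have "last q \<notin> set (butlast p)" if q: "q \<in> F" for q
    proof (cases "q = p")
      case True
      have "distinct (butlast p @ [last p])"
        using linkF(1,3)[OF p] unfolding simple_path_def by simp
      then show ?thesis using True by simp
    next
      case False
      then have "set q \<inter> set p = {}" using D p q by blast
      then show ?thesis using last_in_set[OF linkF(3)[OF q]] in_set_butlastD by fastforce
    qed
    ultimately show ?thesis using linkF[OF p] p unfolding set_path_def T_def by blast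
  qed
  have finF: "finite F" using fin F_def by simp
  have cardF: "card F = n + l" unfolding F_def using fin cd dj(2) by (simp add: card_Un_disjoint)
  have disF: "disjoint_lists F" using D unfolding pairwise_def by blast
  have sep: "\<exists>p. simple_path (adj ?Z) p \<and> hd p \<in> star c \<and> last p \<in> T \<and> set p \<inter> S = {}"
    if "finite S" "card S \<le> card F" for S
  proof -
    \<comment> \<open>Besides at most \<open>n + l\<close> forbidden nodes only \<open>b\<close>
      costs connectivity, and \<open>n + l + 1 < k\<close> because \<open>m > 0\<close>.\<close>
    have "?Z - {c, a} = {b}" using ne by auto
    then have "card S + card (?Z - {c, a}) < k" using that(2) cardF m by simp
    from k_connected_node_path[OF k that(1) _ this] V ne show ?thesis unfolding T_def by blast
  qed
  obtain N y where N: "finite N" "disjoint_lists N" "\<And>p. p \<in> N \<Longrightarrow> set_path (adj ?Z) (star c) T p"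
    "y \<notin> last ` F" "last ` N = insert y (last ` F)"
    using menger_augment_one[OF finF disF pathF sep] by metis
  have Nne: "p \<noteq> []" if "p \<in> N" for p using N(3)[OF that] by (simp add: set_path_def simple_path_def)
  have Nset: "set p = insert (last p) (set (butlast p))" "set (butlast p) \<inter> T = {}" if "p \<in> N" for p
    using set_eq_insert_last_butlast[OF Nne[OF that]] N(3)[OF that] by (auto simp: set_path_def)
  have Nlk: "simple_path (adj ?Z) p" "hd p \<in> star c" if "p \<in> N" for p
    using N(3)[OF that] by (auto simp: set_path_def)
  have ND: "set p \<inter> set q = {}" if "p \<in> N" "q \<in> N" "p \<noteq> q" for p q
    using N(2) that unfolding pairwise_def by blast
  have injN: "inj_on last N" using inj_on_last_disjoint_lists[OF N(2)] Nne by blast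
  have injF: "inj_on last F" using inj_on_last_disjoint_lists[OF disF] linkF(3) by blast
  \<comment> \<open>The new paths are sorted by their ends: those ending where \<open>P\<close> or
    \<open>Q\<close> ended inherit the class.\<close>
  define P' where "P' = {p \<in> N. last p \<in> last ` P}"
  define Q' where "Q' = {p \<in> N. last p \<in> last ` Q}"
  have sub: "card {p \<in> N. last p \<in> last ` X} = card X" if "X \<subseteq> F" for X
  proof -
    have "last ` {p \<in> N. last p \<in> last ` X} = last ` N \<inter> last ` X" by auto
    then have "last ` {p \<in> N. last p \<in> last ` X} = last ` X" using N(5) that by auto
    moreover have "inj_on last {p \<in> N. last p \<in> last ` X}" using injN by (rule inj_on_subset) auto
    moreover have "inj_on last X" using injF that by (rule inj_on_subset)
    ultimately show ?thesis
      using card_image[of last X] card_image[of last "{p \<in> N. last p \<in> last ` X}"] by simp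
  qed
  have cardPQ: "card P' = n" "card Q' = l"
    using sub[of P] sub[of Q] cd unfolding P'_def Q'_def F_def by auto
  have "last ` P \<inter> last ` Q = {}"
    using injF dj(2) unfolding F_def inj_on_def by blast
  then have P'Q': "P' \<inter> Q' = {}" unfolding P'_def Q'_def by blast
  have PQN: "P' \<union> Q' \<subseteq> N" unfolding P'_def Q'_def by blast
  have lkP': "link ?Z c b p" if "p \<in> P'" for p
  proof -
    have "last p \<in> star b" using that lk(2) unfolding P'_def link_def by auto
    then show ?thesis using that Nlk unfolding P'_def link_def by blast
  qed
  have lkQ': "link ?Z c a p" if "p \<in> Q'" for p
  proof -
    have "last p \<in> star a" using that lk(3) unfolding Q'_def link_def by auto
    then show ?thesis using that Nlk unfolding Q'_def link_def by blast
  qed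
  \<comment> \<open>Such a path ends at an old end, which lies on no member of \<open>R\<close>, and
    its other nodes avoid \<open>T\<close>.\<close>
  have RN: "set r \<inter> set p = {}" if rp: "r \<in> R" "p \<in> P' \<union> Q'" for r p
  proof -
    have pN: "p \<in> N" using rp PQN by blast
    obtain q where q: "q \<in> F" "last p = last q" using rp(2) unfolding P'_def Q'_def F_def by auto
    then have "last p \<notin> set r" using RF[OF rp(1) q(1)] last_in_set[OF linkF(3)[OF q(1)]] by auto
    moreover have "set r \<subseteq> T" using rp(1) unfolding T_def by blast
    then have "set r \<inter> set (butlast p) = {}" using Nset(2)[OF pN] by blast
    ultimately show ?thesis unfolding Nset(1)[OF pN] by simp
  qed
  have "y \<in> last ` N" using N(5) by simp
  then obtain s where s: "s \<in> N" "last s = y" by (metis imageE)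
  have sPQ: "set s \<inter> set p = {}" if "p \<in> P' \<union> Q'" for p
  proof -
    have "last p \<in> last ` F" using that unfolding P'_def Q'_def F_def by auto
    then have "s \<noteq> p" using s N(4) by metis
    then show ?thesis using ND s PQN that by blast
  qed
  have yT: "y \<in> T" using N(3)[OF s(1)] s(2) by (simp add: set_path_def)
  \<comment> \<open>It suffices to find one further link \<open>u\<close> from \<open>c\<close> to
    \<open>a\<close> at the price of a single path of \<open>R\<close>.\<close>
  have assemble: "triad a b c m n (Suc l)"
    if R': "R' \<subseteq> R" "card R' = m" and u: "link ?Z c a u"
      "\<And>r. r \<in> R' \<Longrightarrow> set u \<inter> set r = {}" "\<And>p. p \<in> P' \<union> Q' \<Longrightarrow> set u \<inter> set p = {}" for R' u
  proof -
    have une: "u \<noteq> []" using link_nonempty[OF u(1)] .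
    have notin: "u \<notin> R'" "u \<notin> P' \<union> Q'" using u(2)[of u] u(3)[of u] une by auto
    have RPQ: "R' \<inter> (P' \<union> Q') = {}"
    proof (rule ccontr)
      assume "R' \<inter> (P' \<union> Q') \<noteq> {}"
      then obtain p where "p \<in> R'" "p \<in> P' \<union> Q'" by blast
      then have "set p \<inter> set p = {}" "p \<in> N" using RN R'(1) PQN by blast+
      then show False using Nne by auto
    qed
    have "set p \<inter> set q = {}"
      if pq: "p \<in> R' \<union> P' \<union> insert u Q'" "q \<in> R' \<union> P' \<union> insert u Q'" "p \<noteq> q" for p q
    proof -
      consider "p \<in> R'" "q \<in> R'" | "p \<in> R'" "q \<in> P' \<union> Q'" | "q \<in> R'" "p \<in> P' \<union> Q'"
        | "p \<in> P' \<union> Q'" "q \<in> P' \<union> Q'" | "p = u" "q \<in> R' \<union> P' \<union> Q'"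
        | "q = u" "p \<in> R' \<union> P' \<union> Q'"
        using pq by blast
      then show ?thesis
      proof cases
        case 1 then show ?thesis using D R'(1) pq(3) by blast
      next
        case 2 then show ?thesis using RN R'(1) by blast
      next
        case 3 then show ?thesis using RN R'(1) by blast
      next
        case 4 then show ?thesis using ND PQN pq(3) by blast
      next
        case 5 then show ?thesis using u(2,3) by blast
      next
        case 6 then show ?thesis using u(2,3) by blast
      qed
    qed
    then have "disjoint_lists (R' \<union> P' \<union> insert u Q')" unfolding pairwise_def by blast
    moreover have "finite R'" "finite P'" "finite Q'"
      using R'(1) fin(1) N(1) PQN finite_subset by blast+
    moreover have "card (insert u Q') = Suc l" using cardPQ(2) notin \<open>finite Q'\<close> by simp
    moreover have "R' \<inter> (P' \<union> insert u Q') = {}" "P' \<inter> insert u Q' = {}"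
      using RPQ P'Q' notin by blast+
    moreover have "\<forall>p \<in> R'. link ?Z a b p" using lk(1) R'(1) by blast
    ultimately show ?thesis
      unfolding triad_def using R'(2) cardPQ(1) lkP' lkQ' u(1)
      by (intro exI[of _ R'] exI[of _ P'] exI[of _ "insert u Q'"]) simp
  qed
  \<comment> \<open>If the additional path \<open>s\<close> ends on some \<open>r\<close> in
    \<open>R\<close>, it follows \<open>r\<close> back to \<open>a\<close> and \<open>r\<close> is
    given up. Otherwise \<open>s\<close> already ends at an edge at \<open>a\<close>, and an
    arbitrary path of \<open>R\<close> is dropped.\<close>
  show ?thesis
  proof (cases "\<exists>r \<in> R. y \<in> set r")
    case True
    then obtain r where r: "r \<in> R" "y \<in> set r" by blast
    then obtain r1 r2 where r_eq: "r = r1 @ y # r2" by (meson split_list)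
    have lr: "simple_path (adj ?Z) (r1 @ y # r2)" "hd (r1 @ y # r2) \<in> star a"
      using lk(1)[OF r(1)] unfolding r_eq link_def by auto
    have r1T: "set r1 \<subseteq> T" using r unfolding T_def r_eq by auto
    have "simple_path (adj ?Z) (last s # rev r1)"
      using simple_path_rev[OF symp_adj simple_path_appendD(1)[OF lr(1)]] s(2) by simp
    then have "simple_path (adj ?Z) (s @ rev r1)"
      using Nlk(1)[OF s(1)] Nset(2)[OF s(1)] r1T by (intro simple_path_append) auto
    moreover have "last (s @ rev r1) \<in> star a"
      using lr(2) s(2) by (cases r1) (auto simp: last_rev)
    moreover have "hd (s @ rev r1) \<in> star c" using Nlk(2)[OF s(1)] Nne[OF s(1)] by simp
    ultimately have "link ?Z c a (s @ rev r1)" unfolding link_def by blast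
    moreover have "set (s @ rev r1) \<inter> set r' = {}" if "r' \<in> R - {r}" for r'
    proof -
      have "set r \<inter> set r' = {}" using D[of r r'] that r by blast
      moreover have "set r' \<subseteq> T" using that unfolding T_def by blast
      ultimately show ?thesis using Nset[OF s(1)] s(2) r(2) unfolding r_eq by auto
    qed
    moreover have "set (s @ rev r1) \<inter> set p = {}" if "p \<in> P' \<union> Q'" for p
      using sPQ[OF that] RN[OF r(1) that] unfolding r_eq by auto
    moreover have "card (R - {r}) = m" using cd(1) r(1) fin(1) by simp
    ultimately show ?thesis using assemble[of "R - {r}" "s @ rev r1"] by blast
  next
    case False
    then have "y \<in> star a" using yT N(4) unfolding T_def by blast
    then have "link ?Z c a s" using Nlk[OF s(1)] s(2) unfolding link_def by simp
    moreover have "set s \<inter> set r = {}" if "r \<in> R" for r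
    proof -
      have "set r \<subseteq> T" using that unfolding T_def by blast
      then show ?thesis using Nset[OF s(1)] s(2) False that by auto
    qed
    moreover obtain r where "r \<in> R" using cd(1) by fastforce
    moreover have "card (R - {r}) = m" using cd(1) \<open>r \<in> R\<close> fin(1) by simp
    ultimately show ?thesis using assemble[of "R - {r}" s] sPQ by blast
  qed
qed

section \<open>The initial fan\<close>

lemma adj_insert: "adj Z X Y \<Longrightarrow> X \<noteq> {c} \<Longrightarrow> Y \<noteq> {c} \<Longrightarrow> adj (insert c Z) X Y"
  unfolding adj_def nodes_def by blast

lemma simple_path_adj_insert:
  assumes "simple_path (adj Z) p" "{c} \<notin> set p"
  shows "simple_path (adj (insert c Z)) p"
  using assms successively_mono[of "adj Z" p "adj (insert c Z)"] adj_insert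
  unfolding simple_path_def by metis

text \<open>A fan of \<open>k\<close> paths from \<open>b\<close> is grown with the single node
  \<open>{c}\<close> and all of \<open>star a\<close> as targets. Here \<open>c\<close> is kept as a
  node, so that only one path can end there; the other \<open>k - 1\<close> end at
  \<open>a\<close>.\<close>

lemma triad_base:
  assumes k: "k_connected k G" and V: "a \<in> verts G" "b \<in> verts G" "c \<in> verts G"
    and ne: "a \<noteq> b" "b \<noteq> c" "c \<noteq> a" and k1: "k > 1"
  shows "triad a b c (k - 1) 1 0"
proof -
  let ?Z = "{a, b, c}" and ?B = "insert {c} (star a)"
  have Z: "insert c {a, b} = ?Z" by auto
  \<comment> \<open>The first path is found with \<open>c\<close> deleted, so that
    \<open>{c}\<close> can be appended to it afterwards.\<close>
  have "?Z - {b, c} = {a}" using ne by auto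
  then have "card {} + card (?Z - {b, c}) < k" using k1 by simp
  from k_connected_node_path[OF k _ _ this] V ne obtain q where
    q: "simple_path (adj ?Z) q" "hd q \<in> star b" "last q \<in> star c" by blast
  have qne: "q \<noteq> []" using q(1) by (simp add: simple_path_def)
  have "set q \<subseteq> nodes ?Z" using path_subset_nodes q star_subset_nodes by blast
  moreover have "{c} \<notin> nodes ?Z" by (simp add: singleton_in_nodes_iff)
  ultimately have cq: "{c} \<notin> set q" by blast
  obtain v where v: "last q = {c, v}" "c \<rightarrow> v" using q(3) unfolding star_def by blast
  have "{c} \<in> nodes {a, b}" using V ne singleton_in_nodes_iff by auto
  moreover have "{c} \<subset> last q" using v arc_neq by auto
  moreover have "last q \<in> nodes {a, b}" using q(3) star_subset_nodes by blast
  ultimately have "adj {a, b} (last q) {c}" unfolding adj_def by blast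
  moreover have "successively (adj {a, b}) q"
    using q(1) successively_mono[of "adj ?Z" q "adj {a, b}"] adj_antimono[of "{a, b}" ?Z]
    unfolding simple_path_def by blast
  ultimately have qc: "simple_path (adj {a, b}) (q @ [{c}])"
    using q(1) cq unfolding simple_path_def by (auto simp: successively_append_iff)
  moreover have "set (butlast (q @ [{c}])) \<inter> star a = {}"
    using star_dead_end[OF qc, of b a] q(2) qne ne by simp
  ultimately have F: "set_path (adj {a, b}) (star b) ?B (q @ [{c}])"
    using q(2) qne cq unfolding set_path_def by simp
  have sep: "\<exists>p. simple_path (adj {a, b}) p \<and> hd p \<in> star b \<and> last p \<in> ?B \<and> set p \<inter> S = {}"
    if "finite S" "card S < k" for S
  proof -
    have "{a, b} - {b, a} = {}" by auto
    then have "card S + card ({a, b} - {b, a}) < k" using that(2) by simp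
    from k_connected_node_path[OF k that(1) _ this] V ne show ?thesis by blast
  qed
  \<comment> \<open>Extension preserves the end \<open>{c}\<close>, hence one of the
    \<open>k\<close> paths ends there.\<close>
  have "\<exists>N. finite N \<and> card N = k \<and> disjoint_lists N \<and>
      (\<forall>p \<in> N. set_path (adj {a, b}) (star b) ?B p) \<and> last ` {q @ [{c}]} \<subseteq> last ` N"
    using F sep k1 by (intro menger_extend) auto
  then obtain N where N: "finite N" "card N = k" "disjoint_lists N"
    "\<And>p. p \<in> N \<Longrightarrow> set_path (adj {a, b}) (star b) ?B p" "{c} \<in> last ` N"
    by auto
  obtain s where s: "s \<in> N" "last s = {c}" using N(5) by (metis imageE)
  have ps: "simple_path (adj {a, b}) s" "hd s \<in> star b"
    using N(4)[OF s(1)] unfolding set_path_def by auto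
  have ND: "set p \<inter> set q = {}" if "p \<in> N" "q \<in> N" "p \<noteq> q" for p q
    using N(3) that unfolding pairwise_def by blast
  have cs: "{c} \<in> set s" using s(2) ps(1) last_in_set simple_path_def by metis
  \<comment> \<open>Being disjoint from \<open>s\<close>, these paths avoid \<open>{c}\<close> and
    survive the deletion of \<open>c\<close>.\<close>
  have linkN: "link ?Z b a p" if "p \<in> N - {s}" for p
  proof -
    have "{c} \<notin> set p" using ND[of p s] that s(1) cs by blast
    moreover have p: "simple_path (adj {a, b}) p" "hd p \<in> star b" "last p \<in> ?B"
      using N(4) that unfolding set_path_def by auto
    moreover have "last p \<in> set p" using p(1) unfolding simple_path_def by simp
    ultimately have "simple_path (adj (insert c {a, b})) p" "last p \<in> star a"
      using simple_path_adj_insert by auto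
    then show ?thesis using p(2) unfolding link_def Z by blast
  qed
  \<comment> \<open>Dropping the final \<open>{c}\<close> leaves a list ending at the midpoint of an
    edge at \<open>c\<close>.\<close>
  define s' where "s' = butlast s"
  have s_eq: "s = s' @ [{c}]" using s(2) ps(1) unfolding s'_def simple_path_def by (metis append_butlast_last_id)
  have "{c} \<notin> star b" using arc_neq unfolding star_def by (auto simp: singleton_insert_inj_eq)
  then have s'ne: "s' \<noteq> []" using ps(2) unfolding s_eq by auto
  have s': "simple_path (adj {a, b}) s'" "{c} \<notin> set s'" "adj {a, b} (last s') {c}"
    using ps(1) s'ne unfolding s_eq simple_path_def by (auto simp: successively_append_iff)
  have "last s' \<in> star c"
    using s'(3)
  proof (cases rule: adj_cases)
    case (1 x y)
    then show ?thesis using arc_neq by (metis doubleton_eq_iff insert_absorb2)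
  next
    case (2 x y)
    then show ?thesis unfolding star_def by auto
  qed
  then have "link ?Z b c s'"
    using simple_path_adj_insert[OF s'(1,2)] ps(2) s'ne unfolding link_def Z s_eq by simp
  then have ls: "link ?Z c b (rev s')" by (rule link_rev)
  have sN: "set (rev s') \<inter> set (rev p) = {}" if "p \<in> N - {s}" for p
    using ND[of s p] that s(1) unfolding s_eq by auto
  have "s' \<notin> N - {s}" using sN[of s'] s'ne by auto
  then have "rev s' \<notin> rev ` (N - {s})" by auto
  moreover have "disjoint_lists (rev ` (N - {s}) \<union> {rev s'} \<union> {})"
    unfolding pairwise_def using sN ND by auto
  moreover have "card (rev ` (N - {s})) = k - 1"
    using N(1,2) s(1) by (simp add: card_image inj_on_def)
  moreover have "link ?Z a b p" if "p \<in> rev ` (N - {s})" for p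
    using that linkN link_rev by blast
  ultimately show ?thesis
    unfolding triad_def using N(1) ls
    by (intro exI[of _ "rev ` (N - {s})"] exI[of _ "{rev s'}"] exI[of _ "{}"]) simp
qed

section \<open>Reaching the prescribed numbers of paths\<close>

lemma triad_shift:
  assumes "k_connected k G" "a \<in> verts G" "b \<in> verts G" "c \<in> verts G"
    and "a \<noteq> b" "b \<noteq> c" "c \<noteq> a"
    and "triad a b c (m + j) n l" "m > 0" "m + j + n + l \<le> k"
  shows "triad a b c m n (l + j)"
  using assms(8-10)
proof (induction j arbitrary: l)
  case (Suc j)
  have "triad a b c (m + j) n (Suc l)"
    using Suc.prems by (intro triad_step[OF assms(1-7)]) auto
  then show ?case using Suc.IH[of "Suc l"] Suc.prems by simp
qed simp

text \<open>All surplus paths start out between \<open>a\<close> and \<open>b\<close>. After a swap,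
  \<open>k2 - 1\<close> of them are moved to the pair \<open>c\<close>, \<open>b\<close>; after
  swapping back, \<open>k3\<close> are moved to the pair \<open>c\<close>, \<open>a\<close>. Since
  \<open>k1 > 0\<close>, the condition \<open>m > 0\<close> holds throughout.\<close>

lemma triad_exists:
  assumes k: "k_connected k G" and V: "a \<in> verts G" "b \<in> verts G" "c \<in> verts G"
    and ne: "a \<noteq> b" "b \<noteq> c" "c \<noteq> a"
    and k': "k1 > 0" "k2 > 0" "k = k1 + k2 + k3"
  shows "triad a b c k1 k2 k3"
proof -
  have "triad a b c (k1 + k3 + (k2 - 1)) 1 0"
    using triad_base[OF k V ne] k' by (simp add: algebra_simps)
  then have "triad b a c (k1 + k3) 0 (1 + (k2 - 1))"
    using triad_shift[of k b a c "k1 + k3" "k2 - 1" 0 1] triad_swap k V ne k' by auto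
  then have "triad a b c (k1 + k3) k2 0" using triad_swap k'(2) by force
  then show ?thesis using triad_shift[of k a b c k1 k3 k2 0] k V ne k' by simp
qed

section \<open>From disjoint links to internally disjoint paths\<close>

text \<open>Inner vertices come from disjoint lists and lie outside \<open>Z\<close>, whereas the
  ends lie in \<open>Z\<close>. The paths differ even if both are single edges: the midpoint of the
  first edge of \<open>p\<close> lies on \<open>q\<close>, hence not on \<open>q'\<close>.\<close>

lemma internally_disjoint_vpaths:
  assumes "set q \<inter> set q' = {}" "set q \<subseteq> nodes Z" "set q' \<subseteq> nodes Z"
    and "hd p \<in> Z" "last p \<in> Z" "hd p \<noteq> last p" "hd p' \<in> Z" "last p' \<in> Z" "hd p' \<noteq> last p'"
    and "\<forall>v \<in> internal_verts p. {v} \<in> set q" "\<forall>v \<in> internal_verts p'. {v} \<in> set q'"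
    and "successively (\<lambda>x y. {x, y} \<in> set q) p" "successively (\<lambda>x y. {x, y} \<in> set q') p'"
    and "p \<noteq> []" "p' \<noteq> []"
  shows "internally_disjoint p p'"
proof -
  have set_eq: "set r = {hd r, last r} \<union> internal_verts r" if "r \<noteq> []" "hd r \<noteq> last r" for r :: "'a list"
  proof -
    from that(1) obtain x r' where r: "r = x # r'" by (meson neq_Nil_conv)
    then have "r' \<noteq> []" using that(2) by auto
    then show ?thesis using set_eq_insert_last_butlast[of r'] r unfolding internal_verts_def by auto
  qed
  have int: "v \<notin> Z" if "v \<in> internal_verts p \<or> v \<in> internal_verts p'" for v
    using that assms(2,3,10,11) singleton_in_nodes_iff by blast
  have ii: "internal_verts p \<inter> internal_verts p' = {}" using assms(1,10,11) by blast
  obtain x y r where p_eq: "p = x # y # r" using assms(6,14) by (cases p; cases "tl p") auto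
  then have xy: "{x, y} \<in> set q" using assms(12) by simp
  have succ': "{x, y} \<in> set q'" if "successively (\<lambda>x y. {x, y} \<in> set q') p" using that p_eq by simp
  have "p \<noteq> p'" using succ' assms(1,13) xy by blast
  moreover have "successively (\<lambda>x y. {x, y} \<in> set q') (rev p')"
    using assms(13) by (simp add: insert_commute)
  then have "p \<noteq> rev p'" using succ' assms(1) xy by blast
  moreover have "internal_verts p \<inter> set p' = {}"
    unfolding set_eq[OF assms(15,9)] using int ii assms(7,8) by auto
  moreover have "internal_verts p' \<inter> set p = {}"
    unfolding set_eq[OF assms(14,6)] using int ii assms(4,5) by auto
  ultimately show ?thesis unfolding internally_disjoint_def by blast
qed

end

theorem theorem1p2:
  fixes G :: "('a, 'b) pre_digraph" and k k1 k2 k3 :: nat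
  assumes "k > 0"
    and "graph G" and "k_connected k G"
    and "k1 > 0" and "k2 > 0" and "k1 + k2 + k3 \<le> k"
  shows "linked (fat_triangle k1 k2 k3) G"
proof -
  interpret graph G by fact
  \<comment> \<open>Connectivity is monotone in \<open>k\<close>, so \<open>k\<close> may be lowered
    to the number of edges of the multigraph.\<close>
  have k': "k_connected (k1 + k2 + k3) G"
    using assms(3,6) unfolding k_connected_def by auto
  have "\<exists>\<psi>. (\<forall>e \<in> medges (fat_triangle k1 k2 k3). vpath (\<psi> e) G \<and>
           Upair (hd (\<psi> e)) (last (\<psi> e)) = map_uprod \<phi> (ends (fat_triangle k1 k2 k3) e)) \<and>
         (\<forall>e \<in> medges (fat_triangle k1 k2 k3). \<forall>f \<in> medges (fat_triangle k1 k2 k3).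
            e \<noteq> f \<longrightarrow> internally_disjoint (\<psi> e) (\<psi> f))"
    if \<phi>: "inj_on \<phi> (mverts (fat_triangle k1 k2 k3))"
      "\<phi> ` mverts (fat_triangle k1 k2 k3) \<subseteq> verts G" for \<phi>
  proof -
    define a b c where "a = \<phi> 1" and "b = \<phi> 2" and "c = \<phi> 3"
    let ?Z = "{a, b, c}"
    have V: "a \<in> verts G" "b \<in> verts G" "c \<in> verts G"
      using \<phi>(2) unfolding fat_triangle_def a_def b_def c_def by auto
    have ne: "a \<noteq> b" "b \<noteq> c" "c \<noteq> a"
      using \<phi>(1) unfolding fat_triangle_def a_def b_def c_def inj_on_def by auto
    obtain R P Q where fin: "finite R" "finite P" "finite Q"
      and cd: "card R = k1" "card P = k2" "card Q = k3"
      and dj: "R \<inter> (P \<union> Q) = {}" "P \<inter> Q = {}" "disjoint_lists (R \<union> P \<union> Q)"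
      and links: "\<forall>p \<in> R. link ?Z a b p" "\<forall>p \<in> P. link ?Z c b p" "\<forall>p \<in> Q. link ?Z c a p"
      using triad_exists[OF k' V ne assms(4,5) refl] by (rule triadE)
    note lk = links[THEN bspec]
    obtain fR fP fQ where bij: "bij_betw fR {..<k1} R" "bij_betw fP {..<k2} P" "bij_betw fQ {..<k3} Q"
      using ex_bij_betw_nat_finite fin cd by (metis atLeast0LessThan)
    \<comment> \<open>The orientation follows the links: from \<open>a\<close> to \<open>b\<close>,
      from \<open>c\<close> to \<open>b\<close> and from \<open>c\<close> to \<open>a\<close>. It is
      immaterial for the result, as \<open>Upair\<close> is unordered.\<close>
    define src where "src e = (if fst e = 1 then a else c)" for e :: "nat \<times> nat"
    define trg where "trg e = (if fst e = 3 then a else b)" for e :: "nat \<times> nat"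
    define nd where "nd e = (if fst e = 1 then fR (snd e) else if fst e = 2 then fP (snd e) else fQ (snd e))"
      for e :: "nat \<times> nat"
    let ?M = "medges (fat_triangle k1 k2 k3)"
    have M: "?M = {1} \<times> {..<k1} \<union> {2} \<times> {..<k2} \<union> {3} \<times> {..<k3}" by (simp add: fat_triangle_def)
    have mem: "fR i \<in> R" if "i < k1" for i using bij(1) that by (auto simp: bij_betw_def)
    have mem2: "fP i \<in> P" if "i < k2" for i using bij(2) that by (auto simp: bij_betw_def)
    have mem3: "fQ i \<in> Q" if "i < k3" for i using bij(3) that by (auto simp: bij_betw_def)
    have nd_link: "link ?Z (src e) (trg e) (nd e)" "nd e \<in> R \<union> P \<union> Q" if "e \<in> ?M" for e
      using that mem mem2 mem3 lk unfolding M src_def trg_def nd_def by auto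
    have st: "src e \<in> ?Z" "trg e \<in> ?Z" "src e \<in> verts G" "src e \<noteq> trg e" if "e \<in> ?M" for e
      using that ne V unfolding M src_def trg_def by auto
    have nd_inj: "nd e \<noteq> nd f" if "e \<in> ?M" "f \<in> ?M" "e \<noteq> f" for e f
    proof -
      have inj: "inj_on fR {..<k1}" "inj_on fP {..<k2}" "inj_on fQ {..<k3}"
        using bij by (auto simp: bij_betw_def)
      show ?thesis
      proof (cases "fst e = fst f")
        case True
        then have "snd e \<noteq> snd f" using that(3) by (simp add: prod_eq_iff)
        then show ?thesis using True that(1,2) inj unfolding M nd_def by (auto dest: inj_onD)
      next
        case False
        define cls where "cls i = (if i = 1 then R else if i = 2 then P else Q)" for i :: nat
        have "nd e \<in> cls (fst e)" "nd f \<in> cls (fst f)"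
          using that(1,2) mem mem2 mem3 unfolding M nd_def cls_def by auto
        moreover have "cls (fst e) \<inter> cls (fst f) = {}"
          using that(1,2) False dj(1,2) unfolding M cls_def by auto
        ultimately show ?thesis by auto
      qed
    qed
    define realises where "realises e p \<longleftrightarrow> vpath p G \<and> hd p = src e \<and> last p = trg e \<and>
        (\<forall>v \<in> internal_verts p. {v} \<in> set (nd e)) \<and> successively (\<lambda>x y. {x, y} \<in> set (nd e)) p"
      for e p
    define \<psi> where "\<psi> e = (SOME p. realises e p)" for e
    have "realises e (\<psi> e)" if "e \<in> ?M" for e
      unfolding \<psi>_def using link_imp_vpath[OF nd_link(1)[OF that] st(3,1,2)[OF that]]
      unfolding realises_def by (rule someI_ex)
    then have \<psi>: "vpath (\<psi> e) G" "hd (\<psi> e) = src e" "last (\<psi> e) = trg e"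
      "\<forall>v \<in> internal_verts (\<psi> e). {v} \<in> set (nd e)"
      "successively (\<lambda>x y. {x, y} \<in> set (nd e)) (\<psi> e)" if "e \<in> ?M" for e
      using that unfolding realises_def by simp_all
    have "Upair (hd (\<psi> e)) (last (\<psi> e)) = map_uprod \<phi> (ends (fat_triangle k1 k2 k3) e)" if "e \<in> ?M" for e
      using that \<psi>(2,3)[OF that] unfolding M
      by (auto simp: src_def trg_def fat_triangle_def a_def b_def c_def)
    moreover have "internally_disjoint (\<psi> e) (\<psi> f)" if "e \<in> ?M" "f \<in> ?M" "e \<noteq> f" for e f
    proof (rule internally_disjoint_vpaths[where q = "nd e" and q' = "nd f" and Z = ?Z])
      show "set (nd e) \<inter> set (nd f) = {}"
        using dj(3) nd_link(2) nd_inj that unfolding pairwise_def by blast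
      show "set (nd e) \<subseteq> nodes ?Z" "set (nd f) \<subseteq> nodes ?Z"
        using link_subset_nodes nd_link(1) that by blast+
      show "\<psi> e \<noteq> []" "\<psi> f \<noteq> []" using \<psi>(1) that by (auto simp: vpath_def vwalk_def)
    qed (use \<psi> st that in \<open>simp_all del: insert_iff\<close>)
    ultimately show ?thesis using \<psi>(1) by blast
  qed
  then show ?thesis unfolding linked_def by blast
qed

end
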